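(* Let $k\in\mathbb{N}_+$, let $\underline{\lambda}=(\lambda_1,\dots,\lambda_k)\in\mathbb{R}_+^k$, and assume that $k\ge 2$ and that $\sum_{i\in I}\lambda_i<1$ for every $I\subseteq[k]$ with $|I|\le k-2$. Let $G_\infty=G_\infty(r)\sim\mathcal{G}_\infty(\underline{\lambda})$. Then $$f^*_\infty=\sum_{J\subseteq[k]}(-1)^{|J|}\,\Phi_{k-2}\left(\Big(\prod_{i\in[k]\setminus\mathrm{set}(\underline{s})}q_{L_J,\underline{s}i}\Big)_{\underline{s}\in S_{k-2}}\right),$$ where $L_J=\bigcup_{j\in J}S_{k-1}^{\setminus j}$ for $J\subseteq[k]$, and for $L\subseteq S_{k-1}$, $\underline{s}\in S_{k-2}$ and $i\in[k]\setminus\mathrm{set}(\underline{s})$, $$q_{L,\underline{s}i}=\begin{cases}\exp\big(\lambda_i\,(F_{\underline{s}i}(1_-)-1)\big)&\text{if }\underline{s}i\in L,\\ 1&\text{if }\underline{s}i\notin L.\end{cases}$$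
   Context: Notation: $\mathbb{N}_+=\{1,2,\dots\}$, $\mathbb{R}_+=(0,\infty)$, $[k]=\{1,\dots,k\}$. ECBP trees. $G_\infty=G_\infty(r)\sim\mathcal{G}_\infty(\underline{\lambda})$ denotes the random (possibly infinite) edge-colored tree with root $r$ generated recursively: given the tree up to generation $d$, each vertex $v$ in generation $d$ has $X_{v,i}\sim\mathrm{POI}(\lambda_i)$ children joined to it by an edge of color $i$ ($i\in[k]$), all these variables being conditionally independent. For $I\subseteq[k]$, $G_\infty^I$ is the uncolored graph on the same vertex set containing exactly the edges with color in $I$, and $G_\infty^{\setminus i}=G_\infty^{[k]\setminus\{i\}}$. Write $v\stackrel{G_\infty^{\setminus i}}{\longleftrightarrow}w$ if $v,w$ are in the same component of $G_\infty^{\setminus i}$, and $v\stackrel{G_\infty^{\setminus i}}{\longleftrightarrow}\infty$ if there is an infinite path starting at $v$ without edges of color $i$ all of whose vertices are descendants of $v$. The root $r$ and $v$ are $i$-avoiding friends if either $r\stackrel{G_\infty^{\setminus i}}{\longleftrightarrow}v$, or both $r\stackrel{G_\infty^{\setminus i}}{\longleftrightarrow}\infty$ and $v\stackrel{G_\infty^{\setminus i}}{\longleftrightarrow}\infty$; they are friends if they are $i$-avoiding friends for all $i\in[k]$. $\widetilde{\mathcal{C}}^*(r)$ is the set of friends of $r$ (containing $r$), and $f^*_\infty=\mathbb{P}(|\widetilde{\mathcal{C}}^*(r)|=\infty)$. Color strings. For $h\in\{0,\dots,k\}$, $S_h$ is the set of strings $\underline{s}=(i_1,\dots,i_h)$ of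 $h$ pairwise distinct colors in $[k]$ ($S_0=\{\emptyset\}$), $\mathrm{set}(\underline{s})=\{i_1,\dots,i_h\}$, and $\underline{s}i=(i_1,\dots,i_h,i)$ for $i\notin\mathrm{set}(\underline{s})$. For $j\in[k]$, $S_{k-1}^{\setminus j}=\{\underline{s}\in S_{k-1}:\mathrm{set}(\underline{s})=[k]\setminus\{j\}\}$. $\widetilde{R}_{\underline{s}}(r)$ is the set of vertices $v$ of $G_\infty$ such that the set of colors on the path from $r$ to $v$ is exactly $\mathrm{set}(\underline{s})$ and, going from $r$ to $v$, these colors appear for the first time in the order $i_1,\dots,i_h$ (so $\widetilde{R}_\emptyset(r)=\{r\}$). Generating functions. For $\underline{s}\in S_h$, $h\in\{0,\dots,k-1\}$, and $z\in[0,1)$, $F_{\underline{s}}(z)=\mathbb{E}\big(z^{N_{\underline{s}}}\big)$, where $N_{\underline{s}}$ is the number of vertices of the component of $r$ in $G_\infty^{\mathrm{set}(\underline{s})}$ (i.e. the total number of individuals of a branching process with offspring distribution $\mathrm{POI}(\sum_{i\in\mathrm{set}(\underline{s})}\lambda_i)$; $z^\infty=0$), and $F_{\underline{s}}(1_-)=\lim_{z\to1_-}F_{\underline{s}}(z)$. For $h\in\{0,\dots,k-2\}$, $\Phi_h\big((z_{\underline{s}})_{\underline{s}\in S_h}\big)=\mathbb{E}\Big(\prod_{\underline{s}\in S_h}z_{\underline{s}}^{|\widetilde{R}_{\underline{s}}(r)|}\Big)$ for $z_{\underline{s}}\in[0,1]$ (under the assumption of the theorem all the exponents are almost surely finite).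 *)

theory Defs
  imports "HOL-Probability.Probability" "HOL-Library.Sublist"
begin

(* Ulam-Harris encoding: a vertex is the list of (edge color, index among the siblings
   attached by that color) read along the path from the root [] to the vertex. *)
type_synonym vertex = "(nat \<times> nat) list"

(* x v i is the number of children joined to v by an edge of color i *)
inductive_set tree :: "nat \<Rightarrow> (vertex \<Rightarrow> nat \<Rightarrow> nat) \<Rightarrow> vertex set"
  for k :: nat and x :: "vertex \<Rightarrow> nat \<Rightarrow> nat" where
  root: "[] \<in> tree k x"
| child: "v \<in> tree k x \<Longrightarrow> i \<in> {1..k} \<Longrightarrow> n < x v i \<Longrightarrow> v @ [(i, n)] \<in> tree k x"

(* The numbers X \<omega> v i are drawn for all potential vertices v, not only for those
   that occur in the tree; the tree they generate has the law of G_infinity. *)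
locale ecbp = prob_space M for M :: "'w measure" +
  fixes k :: nat and lam :: "nat \<Rightarrow> real" and X :: "'w \<Rightarrow> vertex \<Rightarrow> nat \<Rightarrow> nat"
  assumes indep: "indep_vars (\<lambda>_. count_space UNIV) (\<lambda>(v, i) \<omega>. X \<omega> v i) (UNIV \<times> {1..k})"
    and poisson: "\<And>v i. i \<in> {1..k} \<Longrightarrow>
      distr M (count_space UNIV) (\<lambda>\<omega>. X \<omega> v i) = measure_pmf (poisson_pmf (lam i))"

(* Adjacency in the graph on the vertices of the tree that keeps exactly the edges with color in I *)
definition edges_in :: "nat \<Rightarrow> (vertex \<Rightarrow> nat \<Rightarrow> nat) \<Rightarrow> nat set \<Rightarrow> (vertex \<times> vertex) set" where
  "edges_in k x I = {(u, w). u \<in> tree k x \<and> w \<in> tree k x \<and>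
     (\<exists>i\<in>I. \<exists>n. w = u @ [(i, n)] \<or> u = w @ [(i, n)])}"

definition component :: "nat \<Rightarrow> (vertex \<Rightarrow> nat \<Rightarrow> nat) \<Rightarrow> nat set \<Rightarrow> vertex \<Rightarrow> vertex set" where
  "component k x I v = {w. (v, w) \<in> (edges_in k x I)\<^sup>*}"

(* prefix v w: w is v itself or a descendant of v *)
definition to_infinity :: "nat \<Rightarrow> (vertex \<Rightarrow> nat \<Rightarrow> nat) \<Rightarrow> nat set \<Rightarrow> vertex \<Rightarrow> bool" where
  "to_infinity k x I v \<longleftrightarrow> (\<exists>p :: nat \<Rightarrow> vertex. p 0 = v \<and> inj p \<and>
     (\<forall>n. prefix v (p n) \<and> (p n, p (Suc n)) \<in> edges_in k x I))"

definition avoiding_friends :: "nat \<Rightarrow> (vertex \<Rightarrow> nat \<Rightarrow> nat) \<Rightarrow> nat \<Rightarrow> vertex \<Rightarrow> vertex \<Rightarrow> bool" where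
  "avoiding_friends k x i r v \<longleftrightarrow>
     v \<in> component k x ({1..k} - {i}) r \<or>
     to_infinity k x ({1..k} - {i}) r \<and> to_infinity k x ({1..k} - {i}) v"

definition friends :: "nat \<Rightarrow> (vertex \<Rightarrow> nat \<Rightarrow> nat) \<Rightarrow> vertex \<Rightarrow> vertex set" where
  "friends k x r = {v \<in> tree k x. \<forall>i\<in>{1..k}. avoiding_friends k x i r v}"

definition f_star :: "'w measure \<Rightarrow> nat \<Rightarrow> ('w \<Rightarrow> vertex \<Rightarrow> nat \<Rightarrow> nat) \<Rightarrow> real" where
  "f_star M k X = measure M {\<omega> \<in> space M. infinite (friends k (X \<omega>) [])}"

definition strings :: "nat \<Rightarrow> nat \<Rightarrow> nat list set" where
  "strings k h = {s. length s = h \<and> distinct s \<and> set s \<subseteq> {1..k}}"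

definition strings_avoiding :: "nat \<Rightarrow> nat \<Rightarrow> nat list set" where
  "strings_avoiding k j = {s \<in> strings k (k - 1). set s = {1..k} - {j}}"

(* map fst v is the list of colors on the path from the root to v, and rev (remdups (rev xs))
   keeps the first occurrence of every element of xs (remdups keeps the last one). *)
definition R_set :: "nat \<Rightarrow> (vertex \<Rightarrow> nat \<Rightarrow> nat) \<Rightarrow> nat list \<Rightarrow> vertex set" where
  "R_set k x s = {v \<in> tree k x. rev (remdups (rev (map fst v))) = s}"

(* z to the power of the cardinality of A for z in [0,1], where z^infinity is the limit of z^n *)
definition pow_card :: "real \<Rightarrow> 'a set \<Rightarrow> real" where
  "pow_card z A = (if finite A then z ^ card A else if z = 1 then 1 else 0)"

definition F_gen :: "'w measure \<Rightarrow> nat \<Rightarrow> ('w \<Rightarrow> vertex \<Rightarrow> nat \<Rightarrow> nat) \<Rightarrow> nat list \<Rightarrow> real \<Rightarrow> real" where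
  "F_gen M k X s z = (\<integral>\<omega>. pow_card z (component k (X \<omega>) (set s) []) \<partial>M)"

definition F_gen_left1 :: "'w measure \<Rightarrow> nat \<Rightarrow> ('w \<Rightarrow> vertex \<Rightarrow> nat \<Rightarrow> nat) \<Rightarrow> nat list \<Rightarrow> real" where
  "F_gen_left1 M k X s = Lim (at_left 1) (F_gen M k X s)"

definition Phi :: "'w measure \<Rightarrow> nat \<Rightarrow> ('w \<Rightarrow> vertex \<Rightarrow> nat \<Rightarrow> nat) \<Rightarrow> nat \<Rightarrow> (nat list \<Rightarrow> real) \<Rightarrow> real" where
  "Phi M k X h z = (\<integral>\<omega>. (\<Prod>s\<in>strings k h. pow_card (z s) (R_set k (X \<omega>) s)) \<partial>M)"

definition q_weight :: "'w measure \<Rightarrow> nat \<Rightarrow> (nat \<Rightarrow> real) \<Rightarrow> ('w \<Rightarrow> vertex \<Rightarrow> nat \<Rightarrow> nat)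
    \<Rightarrow> nat list set \<Rightarrow> nat list \<Rightarrow> nat \<Rightarrow> real" where
  "q_weight M k lam X L s i =
     (if s @ [i] \<in> L then exp (lam i * (F_gen_left1 M k X (s @ [i]) - 1)) else 1)"

definition L_set :: "nat \<Rightarrow> nat set \<Rightarrow> nat list set" where
  "L_set k J = (\<Union>j\<in>J. strings_avoiding k j)"

end

theory Submission
  imports Defs
begin

text \<open>
  Call a configuration good if, for every color $j$, the root reaches infinity without using
  color $j$.

  If the root has infinitely many friends, the configuration is good: for a color $j$ that blocks
  the root from infinity, all friends lie in the component of the root without color $j$, which is
  finite by Koenig's lemma (\<open>to_infinity_iff\<close>). Conversely, on a good configuration
  every vertex whose own subtree is good is a friend of the root, and almost surely there are
  infinitely many such vertices (\<open>AE_infinite_good_vertices\<close>): the probabilities that no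
  generation from the $d$-th on contains such a vertex are iterates of the offspring generating
  function from a starting point below one (unless good configurations have probability zero), and
  convexity keeps these iterates below the extinction probability. Hence $f^*_\infty$ is the probability of a good configuration
  (\<open>f_star_eq_prob_good\<close>), and inclusion-exclusion over the colors $j$ for which the
  root fails to reach infinity turns it into an alternating sum of the probabilities that the
  components of the root without color $j$ are finite for all $j \in J$.

  Each of these probabilities is a value of $\Phi_{k-2}$ (\<open>prob_all_finite_eq_Phi\<close>).
  The set $K$ of the vertices whose path from the root carries at most $k-2$ colors, here called
  the core, is almost surely finite because it is a union of subcritical branching processes. The
  component without color $j$ leaves the core only through edges that carry a $(k-1)$-st color, and
  it is finite iff all the subtrees hanging from these edges have a finite component in the same
  $k-1$ colors. Given the core, the numbers of these edges and the subtrees behind them have not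
  been explored yet, so they are independent with their original laws, and every slot for such an
  edge of color $i$ at a vertex with first-appearance string $\underline{s}$ contributes the factor
  $q_{L_J,\underline{s}i}$. Collecting equal strings and averaging over the core yields
  $\Phi_{k-2}$.

  The independence is used in one form only: events that depend on disjoint sets of offspring
  numbers are independent (\<open>prob_disjointly_determined\<close>), which gives the branching
  property in \<open>prob_separated_children\<close>.
\<close>

section \<open>Trees, subtrees and components of the root\<close>

lemma tree_snoc:
  "v @ [(i, n)] \<in> tree k x \<longleftrightarrow> v \<in> tree k x \<and> i \<in> {1..k} \<and> n < x v i"
proof
  assume "v @ [(i, n)] \<in> tree k x"
  then show "v \<in> tree k x \<and> i \<in> {1..k} \<and> n < x v i"
    by (cases rule: tree.cases) auto
qed (auto intro: tree.child)

text \<open>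
  Membership of a fixed vertex becomes a condition on finitely many offspring numbers. This form
  shows which numbers matter and that the event is measurable.
\<close>
lemma tree_iff_prefixes:
  "v \<in> tree k x \<longleftrightarrow> (\<forall>u i n. prefix (u @ [(i, n)]) v \<longrightarrow> i \<in> {1..k} \<and> n < x u i)"
proof (induction v rule: rev_induct)
  case Nil
  then show ?case by (auto intro: tree.root)
next
  case (snoc a v)
  obtain i n where a: "a = (i, n)" by (cases a)
  show ?case unfolding a tree_snoc snoc.IH by auto
qed

definition subtree :: "vertex \<Rightarrow> (vertex \<Rightarrow> nat \<Rightarrow> nat) \<Rightarrow> vertex \<Rightarrow> nat \<Rightarrow> nat" where
  "subtree u x = (\<lambda>v. x (u @ v))"

lemma subtree_Nil [simp]: "subtree [] x = x"
  by (simp add: subtree_def)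

lemma subtree_at_Nil [simp]: "subtree u x [] = x u"
  by (simp add: subtree_def)

lemma subtree_subtree [simp]: "subtree v (subtree u x) = subtree (u @ v) x"
  by (simp add: subtree_def)

lemma tree_append: "u @ v \<in> tree k x \<longleftrightarrow> u \<in> tree k x \<and> v \<in> tree k (subtree u x)"
proof (induction v rule: rev_induct)
  case Nil
  then show ?case by (auto intro: tree.root)
next
  case (snoc a v)
  obtain i n where a: "a = (i, n)" by (cases a)
  have "u @ v @ [(i, n)] \<in> tree k x \<longleftrightarrow> u @ v \<in> tree k x \<and> i \<in> {1..k} \<and> n < x (u @ v) i"
    using tree_snoc[of "u @ v" i n k x] by simp
  then show ?case unfolding a tree_snoc snoc.IH by (auto simp: subtree_def)
qed

lemma tree_Cons:
  "(i, n) # w \<in> tree k x \<longleftrightarrow> i \<in> {1..k} \<and> n < x [] i \<and> w \<in> tree k (subtree [(i, n)] x)"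
  using tree_append[of "[(i, n)]" w k x] tree_snoc[of "[]" i n k x] by (auto intro: tree.root)

lemma tree_colors: "v \<in> tree k x \<Longrightarrow> fst ` set v \<subseteq> {1..k}"
  by (induction rule: tree.induct) auto

text \<open>
  The component of the root when only the colors in $I$ are kept (\<open>component_root\<close>),
  without reference to paths that may run upwards.
\<close>
definition below :: "nat \<Rightarrow> (vertex \<Rightarrow> nat \<Rightarrow> nat) \<Rightarrow> nat set \<Rightarrow> vertex set" where
  "below k x I = {v \<in> tree k x. \<forall>e\<in>set v. fst e \<in> I}"

lemma below_all: "below k x {1..k} = tree k x"
  using tree_colors by (force simp: below_def)

lemma below_mono: "I \<subseteq> J \<Longrightarrow> below k x I \<subseteq> below k x J"
  unfolding below_def by blast

lemma component_root: "component k x I [] = below k x I"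
proof (intro set_eqI iffI)
  fix w assume "w \<in> component k x I []"
  then have "([], w) \<in> (edges_in k x I)\<^sup>*" by (simp add: component_def)
  then show "w \<in> below k x I"
  proof (induction rule: rtrancl_induct)
    case base
    then show ?case by (auto simp: below_def intro: tree.root)
  next
    case (step y z)
    then obtain i n where "i \<in> I" "z \<in> tree k x" "z = y @ [(i, n)] \<or> y = z @ [(i, n)]"
      unfolding edges_in_def by blast
    then show ?case using step.IH unfolding below_def by auto
  qed
next
  fix w assume "w \<in> below k x I"
  then have "([], w) \<in> (edges_in k x I)\<^sup>*"
  proof (induction w rule: rev_induct)
    case Nil
    then show ?case by simp
  next
    case (snoc a w)
    obtain i n where a: "a = (i, n)" by (cases a)
    have "w \<in> below k x I" "(w, w @ [a]) \<in> edges_in k x I"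
      using snoc.prems unfolding a by (auto simp: below_def edges_in_def tree_snoc)
    then show ?case using snoc.IH by (meson rtrancl.rtrancl_into_rtrancl)
  qed
  then show "w \<in> component k x I []" by (simp add: component_def)
qed

lemma below_decompose:
  "below k x I = insert [] (\<Union>i\<in>I \<inter> {1..k}. \<Union>n<x [] i. Cons (i, n) ` below k (subtree [(i, n)] x) I)"
proof (intro set_eqI iffI)
  fix w assume w: "w \<in> below k x I"
  show "w \<in> insert [] (\<Union>i\<in>I \<inter> {1..k}. \<Union>n<x [] i. Cons (i, n) ` below k (subtree [(i, n)] x) I)"
  proof (cases w)
    case (Cons a w')
    obtain i n where a: "a = (i, n)" by (cases a)
    have "i \<in> I \<inter> {1..k}" "n < x [] i" "w' \<in> below k (subtree [(i, n)] x) I"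
      using w unfolding Cons a below_def by (auto simp: tree_Cons)
    then show ?thesis unfolding Cons a by blast
  qed simp
next
  fix w assume "w \<in> insert [] (\<Union>i\<in>I \<inter> {1..k}. \<Union>n<x [] i. Cons (i, n) ` below k (subtree [(i, n)] x) I)"
  then show "w \<in> below k x I"
    by (auto simp: below_def tree_Cons intro: tree.root)
qed

text \<open>
  The recursive structure behind the fixed point equations of extinction probabilities.
\<close>
lemma finite_below_iff:
  "finite (below k x I) \<longleftrightarrow>
    (\<forall>i\<in>{1..k}. \<forall>n<x [] i. i \<in> I \<longrightarrow> finite (below k (subtree [(i, n)] x) I))"
proof -
  have "finite (below k x I) \<longleftrightarrow>
      (\<forall>i\<in>I \<inter> {1..k}. \<forall>n<x [] i. finite (Cons (i, n) ` below k (subtree [(i, n)] x) I))"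
    by (subst below_decompose) auto
  also have "\<dots> \<longleftrightarrow> (\<forall>i\<in>{1..k}. \<forall>n<x [] i. i \<in> I \<longrightarrow> finite (below k (subtree [(i, n)] x) I))"
    by (auto simp: finite_image_iff)
  finally show ?thesis .
qed

text \<open>
  Koenig's lemma. An infinite component contains a child of its root whose own component is
  infinite, and iterating this choice builds a descending path. Conversely, an injective path
  that stays below $v$ lies in the component of $v$, although it might make steps upwards.
\<close>
lemma to_infinity_iff:
  assumes v: "v \<in> tree k x"
  shows "to_infinity k x I v \<longleftrightarrow> infinite (below k (subtree v x) I)"
proof
  assume "to_infinity k x I v"
  then obtain p :: "nat \<Rightarrow> vertex" where p: "p 0 = v" "inj p" "\<And>n. prefix v (p n)"
    "\<And>n. (p n, p (Suc n)) \<in> edges_in k x I"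
    unfolding to_infinity_def by blast
  have "p n \<in> (@) v ` below k (subtree v x) I" for n
  proof (induction n)
    case 0
    then show ?case using p(1) by (auto simp: below_def intro: tree.root)
  next
    case (Suc n)
    then obtain w where w: "p n = v @ w" "w \<in> below k (subtree v x) I" by blast
    obtain w' where w': "p (Suc n) = v @ w'" using p(3)[of "Suc n"] by (auto simp: prefix_def)
    have "p (Suc n) \<in> tree k x" using p(4)[of n] by (auto simp: edges_in_def)
    then have t: "w' \<in> tree k (subtree v x)" unfolding w' tree_append by simp
    obtain i m where im: "i \<in> I" "p (Suc n) = p n @ [(i, m)] \<or> p n = p (Suc n) @ [(i, m)]"
      using p(4)[of n] unfolding edges_in_def by blast
    have "w' = w @ [(i, m)] \<or> w = w' @ [(i, m)]" using im(2) unfolding w(1) w' by simp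
    then have "\<forall>e\<in>set w'. fst e \<in> I" using im(1) w(2) unfolding below_def by auto
    then show ?case using t unfolding w' below_def by blast
  qed
  then have "range p \<subseteq> (@) v ` below k (subtree v x) I" by blast
  moreover have "infinite (range p)" using p(2) by (simp add: finite_image_iff)
  ultimately have "infinite ((@) v ` below k (subtree v x) I)" using finite_subset by blast
  then show "infinite (below k (subtree v x) I)" by blast
next
  assume inf: "infinite (below k (subtree v x) I)"
  let ?P = "\<lambda>n u. u \<in> tree k x \<and> prefix v u \<and> length u = length v + n \<and>
    infinite (below k (subtree u x) I) \<and> (n = 0 \<longrightarrow> u = v)"
  let ?Q = "\<lambda>u w. (u, w) \<in> edges_in k x I"
  have "\<exists>p. \<forall>n. ?P n (p n) \<and> ?Q (p n) (p (Suc n))"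
  proof (rule dependent_nat_choice)
    show "\<exists>u. ?P 0 u" using v inf by auto
  next
    fix u n assume u: "?P n u"
    then have "\<not> (\<forall>i\<in>{1..k}. \<forall>n<x u i. i \<in> I \<longrightarrow> finite (below k (subtree (u @ [(i, n)]) x) I))"
      using finite_below_iff[of k "subtree u x" I] by simp
    then obtain i m where im: "i \<in> {1..k}" "m < x u i" "i \<in> I"
      "infinite (below k (subtree (u @ [(i, m)]) x) I)"
      by blast
    have "u @ [(i, m)] \<in> tree k x"
      using u im unfolding tree_snoc by blast
    moreover have "(u, u @ [(i, m)]) \<in> edges_in k x I"
      using u im calculation unfolding edges_in_def by blast
    ultimately have "?P (Suc n) (u @ [(i, m)]) \<and> ?Q u (u @ [(i, m)])"
      using u im(4) by simp
    then show "\<exists>w. ?P (Suc n) w \<and> ?Q u w" by blast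
  qed
  then obtain p where p: "\<forall>n. ?P n (p n) \<and> ?Q (p n) (p (Suc n))" ..
  have len: "length (p n) = length v + n" for n
    using p by blast
  have "inj p"
  proof (rule injI)
    fix a b assume "p a = p b"
    then have "length (p a) = length (p b)" by (rule arg_cong)
    then show "a = b" unfolding len by simp
  qed
  moreover have "p 0 = v"
    using p by blast
  moreover have "\<forall>n. prefix v (p n) \<and> (p n, p (Suc n)) \<in> edges_in k x I"
    using p by blast
  ultimately show "to_infinity k x I v"
    unfolding to_infinity_def by blast
qed

section \<open>Friends of the root and good vertices\<close>

text \<open>
  Friendship in terms of sets of descendants only, so that the set of friends is seen to be
  determined by the offspring numbers in a measurable way.
\<close>
lemma friends_eq:
  "friends k x [] = {v \<in> tree k x. \<forall>i\<in>{1..k}. v \<in> below k x ({1..k} - {i}) \<or>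
     infinite (below k x ({1..k} - {i})) \<and> infinite (below k (subtree v x) ({1..k} - {i}))}"
proof (intro set_eqI)
  fix v
  show "v \<in> friends k x [] \<longleftrightarrow> v \<in> {v \<in> tree k x. \<forall>i\<in>{1..k}. v \<in> below k x ({1..k} - {i}) \<or>
     infinite (below k x ({1..k} - {i})) \<and> infinite (below k (subtree v x) ({1..k} - {i}))}"
  proof (cases "v \<in> tree k x")
    case True
    show ?thesis
      unfolding friends_def avoiding_friends_def component_root mem_Collect_eq
        to_infinity_iff[OF True] to_infinity_iff[OF tree.root] subtree_Nil ..
  next
    case False
    then show ?thesis by (simp add: friends_def)
  qed
qed

definition good :: "nat \<Rightarrow> (vertex \<Rightarrow> nat \<Rightarrow> nat) \<Rightarrow> bool" where
  "good k x \<longleftrightarrow> (\<forall>i\<in>{1..k}. infinite (below k x ({1..k} - {i})))"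

definition good_vertices :: "nat \<Rightarrow> (vertex \<Rightarrow> nat \<Rightarrow> nat) \<Rightarrow> vertex set" where
  "good_vertices k x = {v \<in> tree k x. good k (subtree v x)}"

lemma good_if_infinite_friends:
  assumes "infinite (friends k x [])"
  shows "good k x"
  unfolding good_def
proof (intro ballI notI)
  fix i assume i: "i \<in> {1..k}" and fin: "finite (below k x ({1..k} - {i}))"
  then have "friends k x [] \<subseteq> below k x ({1..k} - {i})"
    unfolding friends_eq by blast
  then show False using fin assms finite_subset by blast
qed

lemma infinite_friends_if_good:
  assumes "good k x" "infinite (good_vertices k x)"
  shows "infinite (friends k x [])"
proof -
  have "good_vertices k x \<subseteq> friends k x []"
    using assms(1) unfolding good_vertices_def good_def friends_eq by blast
  then show ?thesis using assms(2) finite_subset by blast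
qed

text \<open>
  The event whose probability is an iterate of the offspring generating function: shifting the
  generation by one moves the condition to the subtrees at the children.
\<close>
definition no_good_from :: "nat \<Rightarrow> nat \<Rightarrow> (vertex \<Rightarrow> nat \<Rightarrow> nat) \<Rightarrow> bool" where
  "no_good_from k d x \<longleftrightarrow> (\<forall>v \<in> good_vertices k x. length v < d)"

lemma good_vertices_Cons:
  "(i, n) # w \<in> good_vertices k x \<longleftrightarrow>
    i \<in> {1..k} \<and> n < x [] i \<and> w \<in> good_vertices k (subtree [(i, n)] x)"
  by (auto simp: good_vertices_def tree_Cons)

lemma no_good_from_Suc:
  "no_good_from k (Suc d) x \<longleftrightarrow>
    (\<forall>i\<in>{1..k}. \<forall>n<x [] i. no_good_from k d (subtree [(i, n)] x))"
proof
  assume L: "no_good_from k (Suc d) x"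
  show "\<forall>i\<in>{1..k}. \<forall>n<x [] i. no_good_from k d (subtree [(i, n)] x)"
    unfolding no_good_from_def
  proof (intro ballI allI impI)
    fix i n w assume "i \<in> {1..k}" "n < x [] i" "w \<in> good_vertices k (subtree [(i, n)] x)"
    then have "(i, n) # w \<in> good_vertices k x" unfolding good_vertices_Cons by simp
    then show "length w < d" using L unfolding no_good_from_def by force
  qed
next
  assume R: "\<forall>i\<in>{1..k}. \<forall>n<x [] i. no_good_from k d (subtree [(i, n)] x)"
  show "no_good_from k (Suc d) x" unfolding no_good_from_def
  proof
    fix v assume v: "v \<in> good_vertices k x"
    show "length v < Suc d"
    proof (cases v)
      case (Cons a w)
      obtain i n where a: "a = (i, n)" by (cases a)
      have "i \<in> {1..k}" "n < x [] i" "w \<in> good_vertices k (subtree [(i, n)] x)"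
        using v unfolding Cons a good_vertices_Cons by auto
      then show ?thesis using R unfolding Cons no_good_from_def by auto
    qed simp
  qed
qed

lemma finite_good_vertices:
  assumes "finite (good_vertices k x)"
  shows "\<exists>d. no_good_from k d x"
proof -
  obtain d where "\<forall>n\<in>length ` good_vertices k x. n < d"
    using assms finite_nat_set_iff_bounded by blast
  then show ?thesis unfolding no_good_from_def by blast
qed

section \<open>Events determined by a set of offspring numbers\<close>

abbreviation config_space :: "nat \<Rightarrow> (vertex \<times> nat \<Rightarrow> nat) measure" where
  "config_space k \<equiv> Pi\<^sub>M (UNIV \<times> {1..k}) (\<lambda>_. count_space UNIV)"

text \<open>
  An event is represented by a predicate on configurations that is measurable and insensitive to
  offspring numbers outside $B$. Agreement is asked for the colors in $[k]$ only, as these are the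
  colors of the edges of the tree.
\<close>
definition determined ::
  "nat \<Rightarrow> (vertex \<times> nat) set \<Rightarrow> ((vertex \<Rightarrow> nat \<Rightarrow> nat) \<Rightarrow> bool) \<Rightarrow> bool" where
  "determined k B Q \<longleftrightarrow> Measurable.pred (config_space k) (\<lambda>c. Q (curry c)) \<and>
     (\<forall>x y. (\<forall>v. \<forall>i\<in>{1..k}. (v, i) \<in> B \<longrightarrow> x v i = y v i) \<longrightarrow> Q x = Q y)"

lemma determined_cong:
  assumes "determined k B Q" "\<And>v i. i \<in> {1..k} \<Longrightarrow> (v, i) \<in> B \<Longrightarrow> x v i = y v i"
  shows "Q x = Q y"
  using assms unfolding determined_def by blast

lemma determinedI:
  assumes "Measurable.pred (config_space k) (\<lambda>c. Q (curry c))"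
    and "\<And>x y. (\<And>v i. i \<in> {1..k} \<Longrightarrow> (v, i) \<in> B \<Longrightarrow> x v i = y v i) \<Longrightarrow> Q x \<Longrightarrow> Q y"
  shows "determined k B Q"
  unfolding determined_def
proof (intro conjI allI impI)
  fix x y :: "vertex \<Rightarrow> nat \<Rightarrow> nat"
  assume *: "\<forall>v. \<forall>i\<in>{1..k}. (v, i) \<in> B \<longrightarrow> x v i = y v i"
  show "Q x = Q y"
    using assms(2)[of x y] assms(2)[of y x] * by auto
qed fact

lemma determined_measurable:
  "determined k B Q \<Longrightarrow> Measurable.pred (config_space k) (\<lambda>c. Q (curry c))"
  by (simp only: determined_def)

lemma determined_mono: "determined k B Q \<Longrightarrow> B \<subseteq> C \<Longrightarrow> determined k C Q"
  unfolding determined_def by blast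

lemma determined_const: "determined k B (\<lambda>_. P)"
  by (simp add: determined_def)

lemma determined_not: "determined k B Q \<Longrightarrow> determined k B (\<lambda>x. \<not> Q x)"
  by (auto simp: determined_def)

lemma determined_conj:
  "determined k B Q \<Longrightarrow> determined k B R \<Longrightarrow> determined k B (\<lambda>x. Q x \<and> R x)"
  unfolding determined_def by (intro conjI pred_intros_logic) blast+

lemma determined_disj:
  "determined k B Q \<Longrightarrow> determined k B R \<Longrightarrow> determined k B (\<lambda>x. Q x \<or> R x)"
  unfolding determined_def by (intro conjI pred_intros_logic) blast+

lemma determined_imp:
  "determined k B Q \<Longrightarrow> determined k B R \<Longrightarrow> determined k B (\<lambda>x. Q x \<longrightarrow> R x)"
  unfolding determined_def by (intro conjI pred_intros_logic) blast+

lemma determined_all: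
  fixes Q :: "'a::countable \<Rightarrow> _"
  shows "(\<And>a. determined k B (Q a)) \<Longrightarrow> determined k B (\<lambda>x. \<forall>a. Q a x)"
  unfolding determined_def by (intro conjI pred_intros_countable) blast+

lemma determined_ex:
  fixes Q :: "'a::countable \<Rightarrow> _"
  shows "(\<And>a. determined k B (Q a)) \<Longrightarrow> determined k B (\<lambda>x. \<exists>a. Q a x)"
  unfolding determined_def by (intro conjI pred_intros_countable) blast+

lemma determined_ball:
  fixes Q :: "'a::countable \<Rightarrow> _"
  assumes "\<And>a. a \<in> A \<Longrightarrow> determined k B (Q a)"
  shows "determined k B (\<lambda>x. \<forall>a\<in>A. Q a x)"
  unfolding Ball_def
proof (rule determined_all)
  fix a show "determined k B (\<lambda>x. a \<in> A \<longrightarrow> Q a x)"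
    using assms[of a] by (cases "a \<in> A") (simp_all add: determined_const)
qed

lemma determined_count:
  assumes "i \<in> {1..k}"
  shows "determined k {(v, i)} (\<lambda>x. R (x v i))"
proof (rule determinedI)
  have [measurable]: "(\<lambda>c. c (v, i)) \<in> config_space k \<rightarrow>\<^sub>M count_space UNIV"
    using assms by (intro measurable_component_singleton) auto
  show "Measurable.pred (config_space k) (\<lambda>c. R (curry c v i))"
    unfolding curry_def by measurable
qed (use assms in auto)

text \<open>
  A subset of a countable type is finite iff it is bounded in a fixed enumeration; this writes
  finiteness with countable quantifiers.
\<close>
lemma determined_finite:
  fixes A :: "_ \<Rightarrow> 'a::countable set"
  assumes "\<And>a. determined k B (\<lambda>x. a \<in> A x)"
  shows "determined k B (\<lambda>x. finite (A x))"
proof -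
  have "finite (A x) \<longleftrightarrow> (\<exists>n. \<forall>a. a \<in> A x \<longrightarrow> to_nat a < n)" for x
  proof -
    have "finite (A x) \<longleftrightarrow> finite (to_nat ` A x)"
      by (simp add: finite_image_iff)
    then show ?thesis by (auto simp: finite_nat_set_iff_bounded)
  qed
  then show ?thesis
    by (simp only:) (intro determined_ex determined_all determined_imp determined_const assms)
qed

lemma determined_subtree:
  assumes Q: "determined k B Q" and C: "\<And>w i. (w, i) \<in> B \<Longrightarrow> (u @ w, i) \<in> C"
  shows "determined k C (\<lambda>x. Q (subtree u x))"
proof (rule determinedI)
  let ?f = "\<lambda>c. \<lambda>p\<in>UNIV \<times> {1..k}. c (u @ fst p, snd p)"
  have f: "?f \<in> config_space k \<rightarrow>\<^sub>M config_space k"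
    by (intro measurable_restrict measurable_component_singleton) auto
  have eq: "(\<lambda>c. Q (subtree u (curry c))) = (\<lambda>c. Q (curry (?f c)))"
    by (intro ext determined_cong[OF Q]) (simp add: subtree_def curry_def)
  show "Measurable.pred (config_space k) (\<lambda>c. Q (subtree u (curry c)))"
    unfolding eq by (rule measurable_compose[OF f determined_measurable[OF Q]])
next
  fix x y :: "vertex \<Rightarrow> nat \<Rightarrow> nat"
  assume *: "\<And>v i. i \<in> {1..k} \<Longrightarrow> (v, i) \<in> C \<Longrightarrow> x v i = y v i" and "Q (subtree u x)"
  moreover have "Q (subtree u x) = Q (subtree u y)"
    using C by (intro determined_cong[OF Q]) (auto simp: subtree_def intro!: *)
  ultimately show "Q (subtree u y)" by simp
qed

lemma determined_tree: "determined k {(u, i). \<exists>n. prefix (u @ [(i, n)]) v} (\<lambda>x. v \<in> tree k x)"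
proof -
  have "determined k {(u, i). \<exists>n. prefix (u @ [(i, n)]) v}
      (\<lambda>x. prefix (u @ [(i, n)]) v \<longrightarrow> i \<in> {1..k} \<and> n < x u i)" for u i n
  proof (cases "prefix (u @ [(i, n)]) v \<and> i \<in> {1..k}")
    case True
    then show ?thesis
      by (auto intro!: determined_mono[OF determined_count[of i k u "\<lambda>m. n < m"]])
  next
    case False
    then have "(\<lambda>x. prefix (u @ [(i, n)]) v \<longrightarrow> i \<in> {1..k} \<and> n < x u i)
        = (\<lambda>_. \<not> prefix (u @ [(i, n)]) v)"
      by auto
    then show ?thesis by (simp only: determined_const)
  qed
  then show ?thesis
    unfolding tree_iff_prefixes by (intro determined_all)
qed

lemma determined_in_below: "determined k UNIV (\<lambda>x. v \<in> below k x I)"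
  unfolding below_def mem_Collect_eq
  by (intro determined_conj determined_const determined_mono[OF determined_tree]) simp

lemma determined_finite_below: "determined k UNIV (\<lambda>x. finite (below k x I))"
  by (intro determined_finite determined_in_below)

lemma determined_good: "determined k UNIV (good k)"
  unfolding good_def[abs_def]
  by (intro determined_ball determined_not determined_finite_below)

lemma determined_in_good_vertices: "determined k UNIV (\<lambda>x. v \<in> good_vertices k x)"
  unfolding good_vertices_def mem_Collect_eq
  by (intro determined_conj determined_mono[OF determined_tree] determined_subtree[OF determined_good])
    auto

lemma determined_no_good_from: "determined k UNIV (no_good_from k d)"
  unfolding no_good_from_def[abs_def] Ball_def
  by (intro determined_all determined_imp determined_in_good_vertices determined_const)

lemma determined_infinite_friends: "determined k UNIV (\<lambda>x. infinite (friends k x []))"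
proof -
  have "determined k UNIV (\<lambda>x. v \<in> friends k x [])" for v
    unfolding friends_eq mem_Collect_eq
    by (intro determined_conj determined_disj determined_ball determined_not determined_in_below
        determined_finite_below determined_mono[OF determined_tree]
        determined_subtree[OF determined_finite_below]) simp_all
  then show ?thesis
    by (intro determined_not determined_finite)
qed

section \<open>Independence and invariance under passing to a subtree\<close>

context ecbp
begin

lemma pred_determined:
  assumes Q: "determined k B Q"
  shows "Measurable.pred M (\<lambda>\<omega>. Q (X \<omega>))"
proof -
  let ?f = "\<lambda>\<omega>. \<lambda>p\<in>UNIV \<times> {1..k}. X \<omega> (fst p) (snd p)"
  have f: "?f \<in> M \<rightarrow>\<^sub>M config_space k"
    using indep by (intro measurable_restrict) (auto simp: indep_vars_def split_beta)
  have eq: "(\<lambda>\<omega>. Q (X \<omega>)) = (\<lambda>\<omega>. Q (curry (?f \<omega>)))"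
    by (intro ext determined_cong[OF Q]) (simp add: curry_def)
  show ?thesis
    unfolding eq by (rule measurable_compose[OF f determined_measurable[OF Q]])
qed

text \<open>
  Each of the predicates factors through the family of coordinates in its own block, and the
  restrictions of an independent family to disjoint blocks are independent.
\<close>
lemma prob_disjointly_determined:
  assumes L: "finite L" and Q: "\<And>l. l \<in> L \<Longrightarrow> determined k (B l) (Q l)"
    and disj: "disjoint_family_on B L"
  shows "\<P>(\<omega> in M. \<forall>l\<in>L. Q l (X \<omega>)) = (\<Prod>l\<in>L. \<P>(\<omega> in M. Q l (X \<omega>)))"
proof (cases "L = {}")
  case True
  then show ?thesis by (simp add: prob_space)
next
  case False
  define K where "K l = B l \<inter> (UNIV \<times> {1..k})" for l
  let ?Y = "\<lambda>l \<omega>. \<lambda>p\<in>K l. (case p of (v, i) \<Rightarrow> \<lambda>\<omega>. X \<omega> v i) \<omega>"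
  have "indep_vars (\<lambda>l. Pi\<^sub>M (K l) (\<lambda>_. count_space UNIV)) ?Y L"
    by (rule indep_vars_restrict[OF indep])
      (use disj in \<open>auto simp: K_def disjoint_family_on_def\<close>)
  moreover have "Measurable.pred (Pi\<^sub>M (K l) (\<lambda>_. count_space UNIV)) (\<lambda>c. Q l (curry c))"
    if l: "l \<in> L" for l
  proof -
    let ?f = "\<lambda>c. \<lambda>p\<in>UNIV \<times> {1..k}. if p \<in> K l then c p else 0"
    have "(\<lambda>c. if p \<in> K l then c p else 0) \<in> Pi\<^sub>M (K l) (\<lambda>_. count_space UNIV) \<rightarrow>\<^sub>M count_space UNIV" for p
      by (cases "p \<in> K l") auto
    then have f: "?f \<in> Pi\<^sub>M (K l) (\<lambda>_. count_space UNIV) \<rightarrow>\<^sub>M config_space k"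
      by (intro measurable_restrict)
    have eq: "(\<lambda>c. Q l (curry c)) = (\<lambda>c. Q l (curry (?f c)))"
      by (intro ext determined_cong[OF Q[OF l]]) (simp add: curry_def K_def)
    show ?thesis
      by (subst eq) (rule measurable_compose[OF f determined_measurable[OF Q[OF l]]])
  qed
  ultimately have iv: "indep_vars (\<lambda>_. count_space UNIV) (\<lambda>l \<omega>. Q l (curry (?Y l \<omega>))) L"
    by (rule indep_vars_compose2)
  have eq: "Q l (curry (?Y l \<omega>)) = Q l (X \<omega>)" if "l \<in> L" for l \<omega>
    by (rule determined_cong[OF Q[OF that]]) (simp add: curry_def K_def)
  have "prob (\<Inter>l\<in>L. (\<lambda>\<omega>. Q l (curry (?Y l \<omega>))) -` {True} \<inter> space M) =
      (\<Prod>l\<in>L. prob ((\<lambda>\<omega>. Q l (curry (?Y l \<omega>))) -` {True} \<inter> space M))"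
    using False L by (intro indep_varsD_finite[OF iv]) auto
  also have "(\<Inter>l\<in>L. (\<lambda>\<omega>. Q l (curry (?Y l \<omega>))) -` {True} \<inter> space M) =
      {\<omega> \<in> space M. \<forall>l\<in>L. Q l (X \<omega>)}"
    using False eq by auto
  also have "(\<Prod>l\<in>L. prob ((\<lambda>\<omega>. Q l (curry (?Y l \<omega>))) -` {True} \<inter> space M)) =
      (\<Prod>l\<in>L. \<P>(\<omega> in M. Q l (X \<omega>)))"
    by (intro prod.cong refl arg_cong[of _ _ prob]) (auto simp: eq)
  finally show ?thesis .
qed

text \<open>
  Both configurations have independent Poisson entries with a rate that depends on the color alone,
  and moving the root to $u$ preserves colors; so they have the same law.
\<close>
lemma prob_subtree:
  assumes Q: "determined k B Q"
  shows "\<P>(\<omega> in M. Q (subtree u (X \<omega>))) = \<P>(\<omega> in M. Q (X \<omega>))"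
proof (cases "k = 0")
  case True
  then have "Q (subtree u x) = Q x" for x
    by (intro determined_cong[OF Q]) simp
  then show ?thesis by simp
next
  case False
  let ?I = "(UNIV :: vertex set) \<times> {1..k}"
  let ?N = "\<lambda>p :: vertex \<times> nat. measure_pmf (poisson_pmf (lam (snd p)))"
  let ?f = "\<lambda>\<omega>. \<lambda>p\<in>?I. (case p of (v, i) \<Rightarrow> \<lambda>\<omega>. X \<omega> v i) \<omega>"
  let ?g = "\<lambda>c :: vertex \<times> nat \<Rightarrow> nat. \<lambda>p\<in>?I. c (u @ fst p, snd p)"
  have rv: "random_variable (count_space UNIV) (case p of (v, i) \<Rightarrow> \<lambda>\<omega>. X \<omega> v i)" if "p \<in> ?I" for p
    using indep that by (auto simp: indep_vars_def)
  have f [measurable]: "?f \<in> M \<rightarrow>\<^sub>M config_space k"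
    by (intro measurable_restrict rv)
  have g [measurable]: "?g \<in> config_space k \<rightarrow>\<^sub>M config_space k"
    by (intro measurable_restrict measurable_component_singleton) auto
  note [measurable] = determined_measurable[OF Q]
  have law: "distr M (config_space k) ?f = Pi\<^sub>M ?I ?N"
  proof -
    have "distr M (config_space k) ?f =
        Pi\<^sub>M ?I (\<lambda>p. distr M (count_space UNIV) (case p of (v, i) \<Rightarrow> \<lambda>\<omega>. X \<omega> v i))"
      using indep_vars_iff_distr_eq_PiM'[of ?I "\<lambda>p. case p of (v, i) \<Rightarrow> \<lambda>\<omega>. X \<omega> v i" "\<lambda>_. count_space UNIV"]
        indep rv False by auto
    also have "\<dots> = Pi\<^sub>M ?I ?N"
      by (intro PiM_cong refl) (auto simp: poisson)
    finally show ?thesis .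
  qed
  have "sets (Pi\<^sub>M ?I ?N) = sets (config_space k)"
    by (intro sets_PiM_cong refl) simp
  then have "distr (Pi\<^sub>M ?I ?N) (config_space k) ?g = distr (Pi\<^sub>M ?I ?N) (Pi\<^sub>M ?I ?N) ?g"
    by (intro distr_cong refl) simp
  also have "\<dots> = Pi\<^sub>M ?I ?N"
  proof -
    have "inj_on (\<lambda>p. (u @ fst p, snd p)) ?I" "(\<lambda>p. (u @ fst p, snd p)) \<in> ?I \<rightarrow> ?I"
      by (auto simp: inj_on_def)
    from distr_PiM_reindex[OF _ this, of ?N] show ?thesis
      by (simp only: fst_conv snd_conv prob_space_measure_pmf)
  qed
  finally have law': "distr M (config_space k) (?g \<circ> ?f) = Pi\<^sub>M ?I ?N"
    unfolding law[symmetric] by (simp only: distr_distr[OF g f])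
  have Q1: "Q (X \<omega>) \<longleftrightarrow> Q (curry (?f \<omega>))" for \<omega>
    by (rule determined_cong[OF Q]) (simp add: curry_def)
  have Q2: "Q (subtree u (X \<omega>)) \<longleftrightarrow> Q (curry (?g (?f \<omega>)))" for \<omega>
    by (rule determined_cong[OF Q]) (simp add: curry_def subtree_def)
  have gf: "?g \<circ> ?f \<in> M \<rightarrow>\<^sub>M config_space k"
    using measurable_comp[OF f g] .
  have S: "{c \<in> space (config_space k). Q (curry c)} \<in> sets (config_space k)"
    by measurable
  let ?S = "{c \<in> space (config_space k). Q (curry c)}"
  have "\<P>(\<omega> in M. Q (subtree u (X \<omega>))) = measure (distr M (config_space k) (?g \<circ> ?f)) ?S"
    using measurable_space[OF gf] unfolding Q2 measure_distr[OF gf S]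
    by (intro arg_cong[of _ _ prob]) auto
  also have "\<dots> = measure (distr M (config_space k) ?f) ?S"
    unfolding law law' ..
  also have "\<dots> = \<P>(\<omega> in M. Q (X \<omega>))"
    using measurable_space[OF f] unfolding Q1 measure_distr[OF f S]
    by (intro arg_cong[of _ _ prob]) auto
  finally show ?thesis .
qed

end

section \<open>The branching property\<close>

text \<open>
  The coordinates that decide what happens on the edges of color $i$ at $v$ and beyond them: the
  number of these edges and all offspring numbers in the subtrees behind them.
\<close>
definition block :: "vertex \<Rightarrow> nat \<Rightarrow> (vertex \<times> nat) set" where
  "block v i = {(u, j). u = v \<and> j = i \<or> (\<exists>n. prefix (v @ [(i, n)]) u)}"

lemma determined_children:
  assumes "determined k UNIV Q" "i \<in> {1..k}"
  shows "determined k (block v i) (\<lambda>x. \<forall>n<x v i. Q (subtree (v @ [(i, n)]) x))"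
proof (intro determined_all determined_imp)
  fix n
  show "determined k (block v i) (\<lambda>x. n < x v i)"
    by (rule determined_mono[OF determined_count[OF assms(2)]]) (simp add: block_def)
  show "determined k (block v i) (\<lambda>x. Q (subtree (v @ [(i, n)]) x))"
    by (rule determined_subtree[OF assms(1)]) (auto simp: block_def prefix_def)
qed

text \<open>
  A vertex that lies beyond both families of edges has a prefix in each of them; of two prefixes of
  one vertex, one extends the other, and then one of the two base vertices lies beyond the other,
  unless both edges belong to one family.
\<close>
lemma disjoint_blocks:
  assumes "\<And>n. \<not> prefix (v' @ [(i', n)]) v" "\<And>n. \<not> prefix (v @ [(i, n)]) v'" "(v, i) \<noteq> (v', i')"
  shows "block v i \<inter> block v' i' = {}"
proof -
  have "False" if "prefix (v @ [(i, n)]) u" "prefix (v' @ [(i', n')]) u" for u n n'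
    using prefix_same_cases[OF that] assms by (auto simp only: prefix_snoc append1_eq_conv prod.inject)
  then have "False" if "(u, j) \<in> block v i" "(u, j) \<in> block v' i'" for u j
    using that assms unfolding block_def by blast
  then show ?thesis by auto
qed

locale positive_ecbp = ecbp +
  assumes lam_pos: "\<And>i. i \<in> {1..k} \<Longrightarrow> 0 < lam i"
begin

lemma prob_count:
  assumes i: "i \<in> {1..k}"
  shows "\<P>(\<omega> in M. X \<omega> v i = m) = lam i ^ m / fact m * exp (- lam i)"
proof -
  have rv: "random_variable (count_space UNIV) (\<lambda>\<omega>. X \<omega> v i)"
    using indep i by (auto simp: indep_vars_def)
  have "\<P>(\<omega> in M. X \<omega> v i = m) = measure (distr M (count_space UNIV) (\<lambda>\<omega>. X \<omega> v i)) {m}"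
    by (subst measure_distr[OF rv]) (auto intro!: arg_cong[of _ _ prob])
  also have "\<dots> = pmf (poisson_pmf (lam i)) m"
    unfolding poisson[OF i] by (simp add: pmf.rep_eq)
  finally show ?thesis using lam_pos[OF i] by simp
qed

text \<open>
  Given that there are $m$ children of color $i$, their subtrees have the property independently,
  each with probability $p$; so the probability is $\mathbb{E}(p^{N})$ for a Poisson number $N$,
  that is, $\exp(\lambda_i(p-1))$.
\<close>
lemma prob_children:
  assumes i: "i \<in> {1..k}" and Q: "determined k UNIV Q"
  shows "\<P>(\<omega> in M. \<forall>n<X \<omega> v i. Q (subtree (v @ [(i, n)]) (X \<omega>)))
    = exp (lam i * (\<P>(\<omega> in M. Q (X \<omega>)) - 1))"
proof -
  define p where "p = \<P>(\<omega> in M. Q (X \<omega>))"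
  define A where "A m = {\<omega> \<in> space M. X \<omega> v i = m \<and> (\<forall>n<m. Q (subtree (v @ [(i, n)]) (X \<omega>)))}" for m
  have p: "\<P>(\<omega> in M. Q (subtree u (X \<omega>))) = p" for u
    unfolding p_def by (rule prob_subtree[OF Q])
  have probA: "prob (A m) = lam i ^ m / fact m * exp (- lam i) * p ^ m" for m
  proof -
    \<comment> \<open>Index $m$ stands for the event that there are $m$ children, index $l < m$ for the subtree at
    child number $l$.\<close>
    define R where "R l = (if l = m then (\<lambda>x. x v i = m) else (\<lambda>x. Q (subtree (v @ [(i, l)]) x)))" for l
    define B where "B l = (if l = m then {(v, i)} else {(u, j). prefix (v @ [(i, l)]) u})" for l
    have "(\<forall>l\<in>{..m}. R l x) \<longleftrightarrow> x v i = m \<and> (\<forall>n<m. Q (subtree (v @ [(i, n)]) x))" for x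
      unfolding lessThan_Suc_atMost[symmetric] lessThan_Suc R_def by auto
    then have "A m = {\<omega> \<in> space M. \<forall>l\<in>{..m}. R l (X \<omega>)}"
      unfolding A_def by simp
    also have "prob \<dots> = (\<Prod>l\<in>{..m}. \<P>(\<omega> in M. R l (X \<omega>)))"
    proof (rule prob_disjointly_determined)
      fix l
      have "determined k {(v, i)} (\<lambda>x. x v i = m)"
        by (rule determined_count[OF i])
      moreover have "determined k {(u, j). prefix (v @ [(i, l)]) u} (\<lambda>x. Q (subtree (v @ [(i, l)]) x))"
        by (rule determined_subtree[OF Q]) (auto simp: prefix_def)
      ultimately show "determined k (B l) (R l)"
        unfolding R_def B_def by simp
    next
      have "False" if "prefix (v @ [(i, l)]) u" "prefix (v @ [(i, l')]) u" "l \<noteq> l'" for l l' u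
        using prefix_same_cases[OF that(1,2)] that(3) by (auto simp: prefix_def)
      then show "disjoint_family_on B {..m}"
        unfolding disjoint_family_on_def B_def by (auto simp: prefix_def split: if_splits)
    qed simp
    also have "\<dots> = (\<Prod>l<m. p) * \<P>(\<omega> in M. X \<omega> v i = m)"
      unfolding lessThan_Suc_atMost[symmetric] prod.lessThan_Suc
      by (intro arg_cong2[of _ _ _ _ "(*)"] prod.cong refl) (auto simp: R_def p)
    finally show ?thesis
      unfolding prob_count[OF i] by simp
  qed
  have detA: "determined k UNIV (\<lambda>x. x v i = m \<and> (\<forall>n<m. Q (subtree (v @ [(i, n)]) x)))" for m
    by (intro determined_conj determined_all determined_imp determined_const
        determined_mono[OF determined_count[OF i, where R = "\<lambda>n. n = m"]] determined_subtree[OF Q]) auto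
  have A: "A m \<in> events" for m
    using pred_determined[OF detA] unfolding A_def pred_def .
  have "(\<lambda>m. prob (A m)) sums prob (\<Union>m. A m)"
    by (intro finite_measure_UNION) (use A in \<open>auto simp: disjoint_family_on_def A_def\<close>)
  moreover have "(\<lambda>m. (lam i * p) ^ m /\<^sub>R fact m * exp (- lam i)) sums (exp (lam i * p) * exp (- lam i))"
    by (intro sums_mult2 exp_converges)
  then have "(\<lambda>m. prob (A m)) sums (exp (lam i * p) * exp (- lam i))"
    unfolding probA by (simp add: power_mult_distrib field_simps)
  ultimately have "prob (\<Union>m. A m) = exp (lam i * p) * exp (- lam i)"
    by (rule sums_unique2)
  also have "\<dots> = exp (lam i * (p - 1))"
    by (simp add: exp_add[symmetric] algebra_simps)
  also have "(\<Union>m. A m) = {\<omega> \<in> space M. \<forall>n<X \<omega> v i. Q (subtree (v @ [(i, n)]) (X \<omega>))}"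
    by (auto simp: A_def)
  finally show ?thesis unfolding p_def .
qed

text \<open>
  The branching property. The families of children in $D$ are separated in the sense that no base
  vertex lies beyond another family, so their blocks are disjoint; the event $E$ is what has been
  explored before. With $D$ at the root this is the usual one-step decomposition, and with $D$
  the exits of the core it is the exploration step in the proof of the main formula.
\<close>
lemma prob_separated_children:
  assumes D: "finite D" "D \<subseteq> UNIV \<times> {1..k}"
    and antichain: "\<And>v i v' i' n. (v, i) \<in> D \<Longrightarrow> (v', i') \<in> D \<Longrightarrow> \<not> prefix (v' @ [(i', n)]) v"
    and E: "determined k B E" "\<And>v i. (v, i) \<in> D \<Longrightarrow> B \<inter> block v i = {}"
    and Q: "\<And>v i. (v, i) \<in> D \<Longrightarrow> determined k UNIV (Q v i)"
  shows "\<P>(\<omega> in M. E (X \<omega>) \<and> (\<forall>(v, i)\<in>D. \<forall>n<X \<omega> v i. Q v i (subtree (v @ [(i, n)]) (X \<omega>))))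
    = \<P>(\<omega> in M. E (X \<omega>)) * (\<Prod>(v, i)\<in>D. exp (lam i * (\<P>(\<omega> in M. Q v i (X \<omega>)) - 1)))"
proof -
  define C where "C v i x \<longleftrightarrow> (\<forall>n<x v i. Q v i (subtree (v @ [(i, n)]) x))" for v i x
  \<comment> \<open>The index \<open>None\<close> stands for the event $E$.\<close>
  define R where "R l = (case l of None \<Rightarrow> E | Some (v, i) \<Rightarrow> C v i)" for l
  define B' where "B' l = (case l of None \<Rightarrow> B | Some (v, i) \<Rightarrow> block v i)" for l
  let ?L = "insert None (Some ` D)"
  have "{\<omega> \<in> space M. E (X \<omega>) \<and> (\<forall>(v, i)\<in>D. C v i (X \<omega>))}
      = {\<omega> \<in> space M. \<forall>l\<in>?L. R l (X \<omega>)}"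
    unfolding R_def by auto
  also have "prob \<dots> = (\<Prod>l\<in>?L. \<P>(\<omega> in M. R l (X \<omega>)))"
  proof (rule prob_disjointly_determined)
    show "finite ?L" using D(1) by simp
  next
    fix l assume "l \<in> ?L"
    then show "determined k (B' l) (R l)"
      using E(1) determined_children[OF Q] D(2) by (auto simp: R_def B'_def C_def[abs_def])
  next
    have "block v i \<inter> block v' i' = {}" if "(v, i) \<in> D" "(v', i') \<in> D" "(v, i) \<noteq> (v', i')" for v i v' i'
      using that antichain by (intro disjoint_blocks) blast+
    moreover have "block v i \<inter> B = {}" if "(v, i) \<in> D" for v i
      using E(2)[OF that] by (simp add: Int_commute)
    ultimately show "disjoint_family_on B' ?L"
      using E(2) unfolding disjoint_family_on_def B'_def by (simp add: split_beta prod_eq_iff)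
  qed
  also have "\<dots> = \<P>(\<omega> in M. E (X \<omega>)) * (\<Prod>l\<in>D. \<P>(\<omega> in M. R (Some l) (X \<omega>)))"
    using D(1) by (simp add: prod.reindex R_def)
  also have "(\<Prod>l\<in>D. \<P>(\<omega> in M. R (Some l) (X \<omega>)))
      = (\<Prod>(v, i)\<in>D. exp (lam i * (\<P>(\<omega> in M. Q v i (X \<omega>)) - 1)))"
    using D(2) by (intro prod.cong refl) (auto simp: R_def C_def prob_children Q)
  finally show ?thesis unfolding C_def .
qed

lemma prob_root_children:
  assumes Q: "\<And>i. i \<in> {1..k} \<Longrightarrow> determined k UNIV (Q i)"
  shows "\<P>(\<omega> in M. \<forall>i\<in>{1..k}. \<forall>n<X \<omega> [] i. Q i (subtree [(i, n)] (X \<omega>)))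
    = exp (\<Sum>i\<in>{1..k}. lam i * (\<P>(\<omega> in M. Q i (X \<omega>)) - 1))"
proof -
  have "\<P>(\<omega> in M. True \<and> (\<forall>(v, i)\<in>{[]} \<times> {1..k}. \<forall>n<X \<omega> v i. Q i (subtree (v @ [(i, n)]) (X \<omega>))))
    = \<P>(\<omega> in M. True) * (\<Prod>(v, i)\<in>{[]::vertex} \<times> {1..k}. exp (lam i * (\<P>(\<omega> in M. Q i (X \<omega>)) - 1)))"
    by (rule prob_separated_children[where B = "{}" and E = "\<lambda>_. True" and Q = "\<lambda>_. Q" and D = "{[]} \<times> {1..k}"])
      (use Q determined_const in auto)
  also have "(\<Prod>(v, i)\<in>{[]::vertex} \<times> {1..k}. exp (lam i * (\<P>(\<omega> in M. Q i (X \<omega>)) - 1)))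
      = exp (\<Sum>i\<in>{1..k}. lam i * (\<P>(\<omega> in M. Q i (X \<omega>)) - 1))"
    unfolding prod.cartesian_product[symmetric] by (simp add: exp_sum)
  finally show ?thesis by (simp add: prob_space)
qed

section \<open>Extinction probabilities\<close>

lemma prob_finite_below_fixpoint:
  assumes I: "I \<subseteq> {1..k}"
  defines "a \<equiv> \<P>(\<omega> in M. finite (below k (X \<omega>) I))"
  shows "a = exp ((\<Sum>i\<in>I. lam i) * (a - 1))"
proof -
  let ?Q = "\<lambda>i x. i \<in> I \<longrightarrow> finite (below k x I)"
  have "a = \<P>(\<omega> in M. \<forall>i\<in>{1..k}. \<forall>n<X \<omega> [] i. ?Q i (subtree [(i, n)] (X \<omega>)))"
    unfolding a_def by (intro arg_cong[of _ _ prob] Collect_cong conj_cong refl finite_below_iff)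
  also have "\<dots> = exp (\<Sum>i\<in>{1..k}. lam i * (\<P>(\<omega> in M. ?Q i (X \<omega>)) - 1))"
    by (rule prob_root_children) (intro determined_imp determined_const determined_finite_below)
  also have "(\<Sum>i\<in>{1..k}. lam i * (\<P>(\<omega> in M. ?Q i (X \<omega>)) - 1)) = (\<Sum>i\<in>I. lam i * (a - 1))"
    using I by (intro sum.mono_neutral_cong_right) (auto simp: a_def prob_space)
  finally show ?thesis by (simp add: sum_distrib_right)
qed

text \<open>
  The probability $a$ of finiteness satisfies $a = \exp(\Lambda(a-1)) \ge 1 + \Lambda(a-1)$, and
  $\Lambda < 1$ leaves only $a = 1$.
\<close>
lemma AE_finite_below_subcritical:
  assumes I: "I \<subseteq> {1..k}" and sub: "(\<Sum>i\<in>I. lam i) < 1"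
  shows "AE \<omega> in M. finite (below k (X \<omega>) I)"
proof -
  let ?L = "\<Sum>i\<in>I. lam i" and ?a = "\<P>(\<omega> in M. finite (below k (X \<omega>) I))"
  have "1 + ?L * (?a - 1) \<le> exp (?L * (?a - 1))"
    by (rule exp_ge_add_one_self)
  also have "\<dots> = ?a"
    by (rule prob_finite_below_fixpoint[OF I, symmetric])
  finally have "1 + ?L * (?a - 1) \<le> ?a" .
  then have "0 \<le> (1 - ?L) * (?a - 1)"
    by (simp add: algebra_simps)
  then have "1 \<le> ?a"
    using sub by (simp add: zero_le_mult_iff)
  then have "?a = 1"
    using prob_le_1 by (intro antisym)
  then show ?thesis
    using prob_Collect_eq_1[OF pred_determined[OF determined_finite_below, unfolded pred_def]] by simp
qed

end

text \<open>
  The map $\varphi(s) = \exp(L(s-1))$ is convex with $\varphi(1) = 1$. If $c < b < 1$ with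
  $\varphi(c) = c$, strict convexity forces $\varphi(b) < b$. The proof compares $\varphi$ at $c$
  and at $1$ with its tangent at $b$: the slope there would have to be both at least one and less
  than one.
\<close>
lemma convex_fixpoint_bound:
  fixes b c L :: real
  assumes "0 \<le> L" "b < 1" "b \<le> exp (L * (b - 1))" "0 \<le> c" "c = exp (L * (c - 1))"
  shows "b \<le> c"
proof (rule ccontr)
  assume "\<not> b \<le> c"
  then have cb: "c < b" by simp
  have L: "0 < L"
  proof (rule ccontr)
    assume "\<not> 0 < L"
    then have "L = 0" using assms(1) by simp
    then show False using assms(2,5) cb by simp
  qed
  define f where "f = exp (L * (b - 1))"
  have f: "b \<le> f" "0 < f" using assms(3) by (simp_all add: f_def)
  \<comment> \<open>The tangent of $\varphi$ at $b$, evaluated at $c$; its slope is $fL$.\<close>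
  have "f * (1 + L * (c - b)) \<le> f * exp (L * (c - b))"
    using f by (intro mult_left_mono exp_ge_add_one_self) simp
  also have "\<dots> = exp (L * (c - 1))"
    by (simp add: f_def exp_add[symmetric] algebra_simps)
  also have "\<dots> = c"
    by (rule assms(5)[symmetric])
  finally have "b - c \<le> f * L * (b - c)"
    using f(1) by (simp add: algebra_simps)
  then have "1 \<le> f * L"
    using cb by simp
  \<comment> \<open>The same tangent evaluated at one, where the inequality is strict.\<close>
  have "1 + L * (1 - b) < exp (L * (1 - b))"
    using L assms(2) ln_add_one_self_less_self[of "L * (1 - b)"]
    by (metis add_pos_pos diff_gt_0_iff_gt exp_less_mono exp_ln mult_pos_pos zero_less_one)
  then have "f * (1 + L * (1 - b)) < f * exp (L * (1 - b))"
    using f(2) by simp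
  also have "\<dots> = 1"
    by (simp add: f_def exp_add[symmetric] algebra_simps)
  finally have "f * L * (1 - b) < 1 - b"
    using f(1) by (simp add: algebra_simps)
  then have "f * L < 1"
    using assms(2) by simp
  then show False using \<open>1 \<le> f * L\<close> by simp
qed

context positive_ecbp
begin

text \<open>
  Let $b_d$ be the probability that no vertex from generation $d$ on has a good subtree, and $c$ the
  extinction probability of the whole tree. Then $b_{d+1} = \varphi(b_d)$ and $b_0 \le b_1$, so
  $b_0 \le c$ unless $b_0 = 1$, and monotonicity of $\varphi$ gives $b_d \le c$ for all $d$. The event
  that the good vertices stop at some generation contains extinction, and its probability
  $\lim_d b_d$ is at most $c$; the two events therefore agree almost surely, and a good
  configuration is not extinct. If $b_0 = 1$, the root itself is almost surely not good.
\<close>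
lemma AE_infinite_good_vertices:
  assumes k: "k \<ge> 1"
  shows "AE \<omega> in M. good k (X \<omega>) \<longrightarrow> infinite (good_vertices k (X \<omega>))"
proof (cases "\<P>(\<omega> in M. no_good_from k 0 (X \<omega>)) < 1")
  case True
  let ?L = "\<Sum>i\<in>{1..k}. lam i"
  define b where "b d = \<P>(\<omega> in M. no_good_from k d (X \<omega>))" for d
  define c where "c = \<P>(\<omega> in M. finite (below k (X \<omega>) {1..k}))"
  have L: "0 \<le> ?L"
    using lam_pos by (intro sum_nonneg) (auto intro: less_imp_le)
  have c: "0 \<le> c" "c = exp (?L * (c - 1))"
    unfolding c_def using prob_finite_below_fixpoint[of "{1..k}"] by simp_all
  have ev [measurable]: "Measurable.pred M (\<lambda>\<omega>. no_good_from k d (X \<omega>))"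
    "Measurable.pred M (\<lambda>\<omega>. finite (below k (X \<omega>) {1..k}))"
    "Measurable.pred M (\<lambda>\<omega>. good k (X \<omega>))" for d
    by (intro pred_determined[OF determined_no_good_from] pred_determined[OF determined_finite_below]
        pred_determined[OF determined_good])+
  have step: "b (Suc d) = exp (?L * (b d - 1))" for d
    unfolding b_def no_good_from_Suc
    by (subst prob_root_children) (simp_all add: determined_no_good_from sum_distrib_right)
  have mono: "no_good_from k d x \<Longrightarrow> no_good_from k (Suc d) x" for d x
    unfolding no_good_from_def by auto
  have "b 0 \<le> b (Suc 0)"
    unfolding b_def by (intro finite_measure_mono) (use mono in auto)
  then have "b 0 \<le> c"
    using True L step[of 0] by (intro convex_fixpoint_bound[OF _ _ _ c]) (simp_all add: b_def)
  have le: "b d \<le> c" for d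
  proof (induction d)
    case (Suc d)
    have "exp (?L * (b d - 1)) \<le> exp (?L * (c - 1))"
      using Suc L by (simp add: mult_left_mono)
    then show ?case unfolding step using c(2) by linarith
  qed fact
  define A where "A d = {\<omega> \<in> space M. no_good_from k d (X \<omega>)}" for d
  define T where "T = {\<omega> \<in> space M. finite (below k (X \<omega>) {1..k})}"
  have "(\<lambda>d. prob (A d)) \<longlonglongrightarrow> prob (\<Union>d. A d)"
    by (intro finite_Lim_measure_incseq incseq_SucI) (use mono in \<open>auto simp: A_def\<close>)
  then have "prob (\<Union>d. A d) \<le> prob T"
    using le by (intro LIMSEQ_le_const2) (auto simp: A_def T_def b_def c_def)
  moreover have sub: "T \<subseteq> (\<Union>d. A d)"
  proof
    fix \<omega> assume w: "\<omega> \<in> T"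
    then have "finite (tree k (X \<omega>))"
      unfolding T_def below_all by blast
    then have "finite (good_vertices k (X \<omega>))"
      by (rule rev_finite_subset) (auto simp: good_vertices_def)
    from finite_good_vertices[OF this] show "\<omega> \<in> (\<Union>d. A d)"
      using w by (simp add: A_def T_def)
  qed
  moreover have [measurable]: "(\<Union>d. A d) \<in> events" "T \<in> events"
    unfolding A_def T_def by measurable
  ultimately have "prob ((\<Union>d. A d) - T) = 0"
    using finite_measure_Diff[of "\<Union>d. A d" T] finite_measure_mono[OF sub] measure_nonneg[of M] by simp
  then have "AE \<omega> in M. \<omega> \<notin> (\<Union>d. A d) - T"
    by (intro AE_not_in) (simp add: null_sets_def emeasure_eq_measure)
  with AE_space show ?thesis
  proof (eventually_elim, intro impI notI)
    fix \<omega> assume w: "\<omega> \<in> space M" "\<omega> \<notin> (\<Union>d. A d) - T"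
      and "good k (X \<omega>)" "finite (good_vertices k (X \<omega>))"
    have "infinite (below k (X \<omega>) ({1..k} - {1}))"
      using \<open>good k (X \<omega>)\<close> k unfolding good_def by simp
    then have "\<omega> \<notin> T"
      using below_mono[of "{1..k} - {1}" "{1..k}"] finite_subset unfolding T_def by blast
    moreover have "\<omega> \<in> (\<Union>d. A d)"
      using finite_good_vertices[OF \<open>finite (good_vertices k (X \<omega>))\<close>] w(1) by (simp add: A_def)
    ultimately show False using w(2) by blast
  qed
next
  case False
  then have "\<P>(\<omega> in M. no_good_from k 0 (X \<omega>)) = 1"
    using prob_le_1 by (intro antisym) simp_all
  then have "AE \<omega> in M. no_good_from k 0 (X \<omega>)"
    using prob_Collect_eq_1[OF pred_determined[OF determined_no_good_from, unfolded pred_def]] by simp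
  then show ?thesis
  proof eventually_elim
    fix \<omega> assume "no_good_from k 0 (X \<omega>)"
    then have "[] \<notin> good_vertices k (X \<omega>)"
      unfolding no_good_from_def by blast
    then show "good k (X \<omega>) \<longrightarrow> infinite (good_vertices k (X \<omega>))"
      by (simp add: good_vertices_def tree.root)
  qed
qed

end

section \<open>The core and its exits\<close>

text \<open>
  With $h = k-2$, this is the union of the sets $\widetilde{R}_{\underline{s}}(r)$ over all strings
  of at most $k-2$ colors.
\<close>
definition core :: "nat \<Rightarrow> nat \<Rightarrow> (vertex \<Rightarrow> nat \<Rightarrow> nat) \<Rightarrow> vertex set" where
  "core k h x = {v \<in> tree k x. card (fst ` set v) \<le> h}"

text \<open>
  The slots $(v,i)$ at which an edge of color $i$, new on the path to $v$, would lead out of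
  the core $K$.
\<close>
definition exits :: "nat \<Rightarrow> nat \<Rightarrow> vertex set \<Rightarrow> (vertex \<times> nat) set" where
  "exits k h K = {(v, i). v \<in> K \<and> card (fst ` set v) = h \<and> i \<in> {1..k} - fst ` set v}"

lemma finite_exits: "finite K \<Longrightarrow> finite (exits k h K)"
  by (rule finite_subset[of _ "K \<times> {1..k}"]) (auto simp: exits_def)

lemma card_colors_extension:
  assumes "(v, i) \<in> exits k h K" "prefix (v @ [(i, n)]) u"
  shows "h < card (fst ` set u)"
proof -
  have "Suc h = card (fst ` set (v @ [(i, n)]))"
    using assms(1) by (simp add: exits_def)
  also have "\<dots> \<le> card (fst ` set u)"
    using assms(2) by (intro card_mono image_mono set_mono_prefix) simp_all
  finally show ?thesis by simp
qed

lemma exits_antichain: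
  "(v, i) \<in> exits k h K \<Longrightarrow> (v', i') \<in> exits k h K \<Longrightarrow> \<not> prefix (v' @ [(i', n)]) v"
  using card_colors_extension[of v' i' k h K n v] by (auto simp: exits_def)

text \<open>
  The path to a vertex of the core has seen at most $h$ colors after each of its edges, so only
  offspring numbers of such edges are consulted.
\<close>
lemma determined_core:
  "determined k {(u, j). card (insert j (fst ` set u)) \<le> h} (\<lambda>x. core k h x = K)"
proof -
  have "determined k {(u, j). card (insert j (fst ` set u)) \<le> h}
      (\<lambda>x. v \<in> tree k x \<and> card (fst ` set v) \<le> h \<longleftrightarrow> v \<in> K)" for v
  proof (cases "card (fst ` set v) \<le> h")
    case True
    have "card (insert j (fst ` set u)) \<le> h" if "prefix (u @ [(j, n)]) v" for u j n
    proof -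
      have "card (fst ` set (u @ [(j, n)])) \<le> card (fst ` set v)"
        using that by (intro card_mono image_mono set_mono_prefix) simp_all
      then show ?thesis using True by simp
    qed
    then have *: "determined k {(u, j). card (insert j (fst ` set u)) \<le> h} (\<lambda>x. v \<in> tree k x)"
      by (intro determined_mono[OF determined_tree]) auto
    show ?thesis
      using True * determined_not[OF *] by (cases "v \<in> K") simp_all
  next
    case False
    then show ?thesis by (simp add: determined_const)
  qed
  then show ?thesis
    unfolding set_eq_iff core_def mem_Collect_eq by (intro determined_all)
qed

text \<open>
  Every vertex beyond an exit carries more than $h$ colors, so knowing the core reveals nothing about
  what lies behind the exits.
\<close>
lemma core_block_disjoint:
  assumes "(v, i) \<in> exits k h K"
  shows "{(u, j). card (insert j (fst ` set u)) \<le> h} \<inter> block v i = {}"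
proof -
  have "h < card (insert j (fst ` set u))" if uj: "(u, j) \<in> block v i" for u j
  proof (cases "u = v \<and> j = i")
    case True
    then show ?thesis using assms by (auto simp: exits_def)
  next
    case False
    then obtain n where "prefix (v @ [(i, n)]) u"
      using uj by (auto simp: block_def)
    then have "h < card (fst ` set u)"
      by (rule card_colors_extension[OF assms])
    also have "\<dots> \<le> card (insert j (fst ` set u))"
      by (intro card_mono) auto
    finally show ?thesis .
  qed
  then show ?thesis by fastforce
qed

text \<open>
  With $h+1$ colors available, a vertex of the component outside the core lies beyond the unique exit
  at which its path acquires its last color, and there the path has seen exactly the colors
  in $I$. So the component consists of a part of the finite core and finitely many pieces, one for
  each edge at an exit.
\<close>
lemma finite_below_exits_iff:
  assumes fin: "finite (core k h x)" and I: "I \<subseteq> {1..k}" "card I = Suc h"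
  shows "finite (below k x I) \<longleftrightarrow>
    (\<forall>(v, i)\<in>exits k h (core k h x). insert i (fst ` set v) = I \<longrightarrow>
      (\<forall>n<x v i. finite (below k (subtree (v @ [(i, n)]) x) I)))"
    (is "_ \<longleftrightarrow> ?R")
proof
  assume L: "finite (below k x I)"
  have "finite (below k (subtree (v @ [(i, n)]) x) I)"
    if vi: "(v, i) \<in> exits k h (core k h x)" "insert i (fst ` set v) = I" and n: "n < x v i" for v i n
  proof -
    have t: "v @ [(i, n)] \<in> tree k x"
      using vi(1) n unfolding tree_snoc exits_def core_def by blast
    have "(@) (v @ [(i, n)]) ` below k (subtree (v @ [(i, n)]) x) I \<subseteq> below k x I"
    proof
      fix w assume "w \<in> (@) (v @ [(i, n)]) ` below k (subtree (v @ [(i, n)]) x) I"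
      then obtain w' where w': "w = (v @ [(i, n)]) @ w'" "w' \<in> below k (subtree (v @ [(i, n)]) x) I"
        by blast
      then have "w \<in> tree k x"
        using t unfolding w'(1) tree_append below_def by blast
      moreover have "\<forall>e\<in>set w. fst e \<in> I"
        using w'(2) vi(2) unfolding w'(1) below_def by auto
      ultimately show "w \<in> below k x I" by (simp add: below_def)
    qed
    then have "finite ((@) (v @ [(i, n)]) ` below k (subtree (v @ [(i, n)]) x) I)"
      using L by (rule finite_subset)
    then show ?thesis by (rule finite_imageD) (simp add: inj_on_def)
  qed
  then show ?R by blast
next
  assume R: ?R
  let ?D = "{(v, i) \<in> exits k h (core k h x). insert i (fst ` set v) = I}"
  let ?U = "\<Union>(v, i)\<in>?D. \<Union>n<x v i. (@) (v @ [(i, n)]) ` below k (subtree (v @ [(i, n)]) x) I"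
  have "w \<in> core k h x \<union> ?U" if "w \<in> below k x I" for w
    using that
  proof (induction w rule: rev_induct)
    case Nil
    then show ?case by (simp add: core_def tree.root)
  next
    case (snoc a w)
    obtain i n where a: "a = (i, n)" by (cases a)
    have t: "w \<in> tree k x" "i \<in> {1..k}" "n < x w i" "\<forall>e\<in>set w. fst e \<in> I" "i \<in> I"
      "w \<in> below k x I"
      using snoc.prems unfolding a below_def by (auto simp: tree_snoc)
    consider "w \<in> ?U" | "w \<in> core k h x" "card (fst ` set (w @ [a])) \<le> h"
      | "w \<in> core k h x" "h < card (fst ` set (w @ [a]))"
      using snoc.IH[OF t(6)] by fastforce
    then show ?case
    proof cases
      case 1
      then obtain v j m w' where v: "(v, j) \<in> ?D" "m < x v j" "w = (v @ [(j, m)]) @ w'"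
        "w' \<in> below k (subtree (v @ [(j, m)]) x) I"
        by blast
      have "w' @ [a] \<in> below k (subtree (v @ [(j, m)]) x) I"
        using v(3,4) t(2,3,5) unfolding a below_def by (auto simp: tree_snoc subtree_def)
      then have "w @ [a] \<in> (@) (v @ [(j, m)]) ` below k (subtree (v @ [(j, m)]) x) I"
        using v(3) by simp
      then show ?thesis using v(1,2) by blast
    next
      case 2
      then show ?thesis
        using snoc.prems by (simp add: core_def below_def)
    next
      case 3
      have "i \<notin> fst ` set w"
      proof
        assume "i \<in> fst ` set w"
        then have "fst ` set (w @ [a]) = fst ` set w" by (auto simp: a)
        then show False using 3 by (simp add: core_def)
      qed
      then have c: "card (fst ` set w) = h"
        using 3 by (simp add: core_def a)
      have sub: "insert i (fst ` set w) \<subseteq> I"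
        using t(4,5) by auto
      moreover have "finite I" using I(1) finite_subset by blast
      moreover have "card (insert i (fst ` set w)) = card I"
        using c I(2) \<open>i \<notin> fst ` set w\<close> by simp
      ultimately have "insert i (fst ` set w) = I"
        by (intro card_subset_eq)
      then have D: "(w, i) \<in> ?D"
        using 3(1) c t(2) \<open>i \<notin> fst ` set w\<close> by (simp add: exits_def)
      have "[] \<in> below k (subtree (w @ [(i, n)]) x) I"
        by (simp add: below_def tree.root)
      then have "w @ [a] \<in> (@) (w @ [(i, n)]) ` below k (subtree (w @ [(i, n)]) x) I"
        by (force simp: a)
      then show ?thesis using D t(3) by blast
    qed
  qed
  then have sub: "below k x I \<subseteq> core k h x \<union> ?U" by blast
  have "finite ?D"
    by (rule finite_subset[OF _ finite_exits[OF fin]]) blast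
  moreover have "finite (\<Union>n<x v i. (@) (v @ [(i, n)]) ` below k (subtree (v @ [(i, n)]) x) I)"
    if "(v, i) \<in> ?D" for v i
    using R that by auto
  ultimately have "finite ?U" by (intro finite_UN_I) auto
  then show "finite (below k x I)"
    using fin sub finite_subset by blast
qed

section \<open>Sorting vertices by the order in which colors appear\<close>

definition first_colors :: "vertex \<Rightarrow> nat list" where
  "first_colors v = rev (remdups (rev (map fst v)))"

lemma set_first_colors: "set (first_colors v) = fst ` set v"
  by (simp add: first_colors_def)

lemma length_first_colors: "length (first_colors v) = card (fst ` set v)"
  by (simp add: first_colors_def length_remdups_card_conv)

lemma first_colors_in_strings:
  assumes "v \<in> tree k x"
  shows "first_colors v \<in> strings k (card (fst ` set v))"
  using tree_colors[OF assms]
  by (simp add: strings_def set_first_colors length_first_colors) (simp add: first_colors_def)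

lemma finite_strings: "finite (strings k h)"
proof -
  have "strings k h \<subseteq> {s. set s \<subseteq> {1..k} \<and> length s = h}"
    by (auto simp: strings_def)
  then show ?thesis
    using finite_lists_length_eq[of "{1..k}" h] finite_subset by blast
qed

text \<open>
  The vertices of the core with exactly $h$ colors are sorted by the order in which their colors
  appear. A vertex with string $s$ contributes one factor for each color outside $s$, that is,
  for each exit at that vertex.
\<close>
lemma prod_strings_eq_prod_exits:
  assumes fin: "finite (core k h x)"
  shows "(\<Prod>s\<in>strings k h. pow_card (\<Prod>i\<in>{1..k} - set s. w s i) (R_set k x s))
    = (\<Prod>(v, i)\<in>exits k h (core k h x). w (first_colors v) i)"
proof -
  let ?V = "{v \<in> core k h x. card (fst ` set v) = h}"
  let ?z = "\<lambda>s. \<Prod>i\<in>{1..k} - set s. w s i"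
  have R: "R_set k x s = {v \<in> ?V. first_colors v = s}" if "s \<in> strings k h" for s
    using that by (auto simp: R_set_def first_colors_def[symmetric] core_def strings_def
        length_first_colors[symmetric])
  have V: "finite ?V" using fin by simp
  have "(\<Prod>s\<in>strings k h. pow_card (?z s) (R_set k x s))
      = (\<Prod>s\<in>strings k h. \<Prod>v\<in>{v \<in> ?V. first_colors v = s}. ?z (first_colors v))"
  proof (intro prod.cong refl)
    fix s assume s: "s \<in> strings k h"
    have "finite {v \<in> ?V. first_colors v = s}"
      using V by (rule rev_finite_subset) blast
    then show "pow_card (?z s) (R_set k x s) = (\<Prod>v\<in>{v \<in> ?V. first_colors v = s}. ?z (first_colors v))"
      unfolding R[OF s] pow_card_def by simp
  qed
  also have "\<dots> = (\<Prod>v\<in>?V. ?z (first_colors v))"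
    using V finite_strings first_colors_in_strings
    by (intro prod.group) (auto simp: core_def)
  also have "\<dots> = (\<Prod>(v, i)\<in>(SIGMA v:?V. {1..k} - fst ` set v). w (first_colors v) i)"
    unfolding set_first_colors using V by (intro prod.Sigma) auto
  also have "(SIGMA v:?V. {1..k} - fst ` set v) = exits k h (core k h x)"
    by (auto simp: exits_def)
  finally show ?thesis .
qed

section \<open>Random sets and generating functions\<close>

text \<open>
  The cardinality is measurable since a finite set is described by a list of its elements, and
  there are only countably many lists.
\<close>
lemma borel_measurable_pow_card:
  fixes A :: "'w \<Rightarrow> 'a::countable set"
  assumes A [measurable]: "\<And>a. Measurable.pred M (\<lambda>\<omega>. a \<in> A \<omega>)"
  shows "(\<lambda>\<omega>. pow_card z (A \<omega>)) \<in> borel_measurable M"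
proof -
  let ?f = "\<lambda>\<omega>. if finite (A \<omega>) then Suc (card (A \<omega>)) else 0"
  have "finite (A \<omega>) \<and> card (A \<omega>) = n \<longleftrightarrow>
      (\<exists>xs. (length xs = n \<and> distinct xs) \<and> (\<forall>a. a \<in> A \<omega> \<longleftrightarrow> a \<in> set xs))" for n \<omega>
    using finite_distinct_list[of "A \<omega>"] distinct_card unfolding set_eq_iff[symmetric] by fastforce
  moreover have "Measurable.pred M
      (\<lambda>\<omega>. \<exists>xs. (length xs = n \<and> distinct xs) \<and> (\<forall>a. a \<in> A \<omega> \<longleftrightarrow> a \<in> set xs))" for n
    by measurable
  ultimately have p: "Measurable.pred M (\<lambda>\<omega>. finite (A \<omega>) \<and> card (A \<omega>) = n)" for n
    by simp
  have "Measurable.pred M (\<lambda>\<omega>. \<exists>n. finite (A \<omega>) \<and> card (A \<omega>) = n)"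
    using p by (rule pred_intros_countable)
  then have [measurable]: "Measurable.pred M (\<lambda>\<omega>. finite (A \<omega>))"
    by simp
  have "?f \<in> M \<rightarrow>\<^sub>M count_space UNIV"
  proof (subst measurable_count_space_eq2_countable, safe)
    \<comment> \<open>The value zero encodes an infinite set.\<close>
    fix m
    have "?f -` {m} \<inter> space M = (if m = 0 then {\<omega> \<in> space M. \<not> finite (A \<omega>)}
        else {\<omega> \<in> space M. finite (A \<omega>) \<and> card (A \<omega>) = m - 1})"
      by (auto split: if_splits)
    also have "\<dots> \<in> sets M"
      using p[of "m - 1"] by simp
    finally show "?f -` {m} \<inter> space M \<in> sets M" .
  qed auto
  then have "(\<lambda>\<omega>. (\<lambda>m. if m = 0 then (if z = 1 then 1 else 0) else z ^ (m - 1)) (?f \<omega>))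
      \<in> borel_measurable M"
    by (rule measurable_compose) simp
  moreover have "(\<lambda>m. if m = 0 then (if z = 1 then 1 else 0) else z ^ (m - 1)) (?f \<omega>)
      = pow_card z (A \<omega>)" for \<omega>
    by (cases "finite (A \<omega>)") (simp_all add: pow_card_def)
  ultimately show ?thesis
    by (simp only:)
qed

text \<open>
  The law of total probability for the partition according to the value of an almost surely finite
  random set. There are only countably many finite sets, and on each cell the integral of
  the difference of the indicator of $E$ and $f$ vanishes.
\<close>
lemma (in prob_space) prob_eq_integral_countable_partition:
  fixes A :: "'a \<Rightarrow> 'b::countable set"
  assumes A: "\<And>a. Measurable.pred M (\<lambda>\<omega>. a \<in> A \<omega>)"
    and fin: "AE \<omega> in M. finite (A \<omega>)"
    and E [measurable]: "Measurable.pred M E"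
    and f: "integrable M f" "\<And>\<omega>. finite (A \<omega>) \<Longrightarrow> f \<omega> = g (A \<omega>)"
    and eq: "\<And>F. finite F \<Longrightarrow> \<P>(\<omega> in M. A \<omega> = F \<and> E \<omega>) = \<P>(\<omega> in M. A \<omega> = F) * g F"
  shows "\<P>(\<omega> in M. E \<omega>) = (\<integral>\<omega>. f \<omega> \<partial>M)"
proof -
  let ?FF = "Collect finite :: 'b set set"
  define B where "B n = {\<omega> \<in> space M. finite (A \<omega>) \<and> to_nat_on ?FF (A \<omega>) = n}" for n
  let ?d = "\<lambda>\<omega>. indicator {\<omega> \<in> space M. E \<omega>} \<omega> - f \<omega>"
  have AF [measurable]: "Measurable.pred M (\<lambda>\<omega>. A \<omega> = F)" for F
    unfolding set_eq_iff by (intro pred_intros_countable pred_intros_logic A) simp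
  have E': "integrable M (indicator {\<omega> \<in> space M. E \<omega>} :: 'a \<Rightarrow> real)"
    by (intro integrable_real_indicator) (simp_all add: emeasure_eq_measure)
  then have d: "integrable M ?d"
    using f(1) by (intro Bochner_Integration.integrable_diff)
  have B: "B n \<in> sets M \<and> (LINT \<omega>:B n|M. ?d \<omega>) = 0" for n
  proof (cases "n \<in> to_nat_on ?FF ` ?FF")
    case True
    then obtain F where F: "finite F" "n = to_nat_on ?FF F" by blast
    have B: "B n = {\<omega> \<in> space M. A \<omega> = F}"
      using F inj_on_to_nat_on[OF countable_Collect_finite] unfolding B_def F(2) inj_on_def by blast
    have "(LINT \<omega>:B n|M. ?d \<omega>) = (\<integral>\<omega>. indicator {\<omega> \<in> space M. A \<omega> = F \<and> E \<omega>} \<omega>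
        - g F * indicator {\<omega> \<in> space M. A \<omega> = F} \<omega> \<partial>M)"
      unfolding set_lebesgue_integral_def B
      by (intro Bochner_Integration.integral_cong refl) (use F(1) f(2) in \<open>auto simp: indicator_def\<close>)
    also have "\<dots> = \<P>(\<omega> in M. A \<omega> = F \<and> E \<omega>) - g F * \<P>(\<omega> in M. A \<omega> = F)"
      by (subst Bochner_Integration.integral_diff) (simp_all add: emeasure_eq_measure)
    also have "\<dots> = 0" using eq[OF F(1)] by simp
    finally show ?thesis unfolding B by simp
  next
    case False
    then have "B n = {}" unfolding B_def by blast
    then show ?thesis by (simp add: set_lebesgue_integral_def)
  qed
  have "(LINT \<omega>:(\<Union>n. B n)|M. ?d \<omega>) = (\<Sum>n. (LINT \<omega>:B n|M. ?d \<omega>))"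
  proof (rule lebesgue_integral_countable_add)
    show "set_integrable M (\<Union>n. B n) ?d"
      unfolding set_integrable_def using B d by (intro integrable_mult_indicator) auto
  qed (use B in \<open>auto simp: B_def\<close>)
  also have "\<dots> = 0" using B by simp
  finally have "(LINT \<omega>:(\<Union>n. B n)|M. ?d \<omega>) = 0" .
  moreover have "(LINT \<omega>:(\<Union>n. B n)|M. ?d \<omega>) = (\<integral>\<omega>. ?d \<omega> \<partial>M)"
    unfolding set_lebesgue_integral_def
  proof (rule integral_cong_AE)
    show "AE \<omega> in M. indicat_real (\<Union>n. B n) \<omega> *\<^sub>R ?d \<omega> = ?d \<omega>"
      using fin AE_space by eventually_elim (auto simp: B_def indicator_def)
    have "(\<Union>n. B n) \<in> sets M" using B by blast
    then show "(\<lambda>\<omega>. indicat_real (\<Union>n. B n) \<omega> *\<^sub>R ?d \<omega>) \<in> borel_measurable M"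
      using d by (intro borel_measurable_integrable integrable_mult_indicator)
  qed (use d in \<open>rule borel_measurable_integrable\<close>)
  ultimately have "(\<integral>\<omega>. ?d \<omega> \<partial>M) = 0" by simp
  then show ?thesis
    using Bochner_Integration.integral_diff[OF E' f(1)] by simp
qed

context ecbp
begin

lemma pred_in_below: "Measurable.pred M (\<lambda>\<omega>. v \<in> below k (X \<omega>) I)"
  by (rule pred_determined[OF determined_in_below])

text \<open>
  As $z$ increases to one, $z^N$ converges to the indicator of $N < \infty$.
\<close>
lemma F_gen_left1_eq: "F_gen_left1 M k X s = \<P>(\<omega> in M. finite (below k (X \<omega>) (set s)))"
proof -
  let ?A = "\<lambda>\<omega>. below k (X \<omega>) (set s)"
  let ?E = "{\<omega> \<in> space M. finite (?A \<omega>)}"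
  have E: "?E \<in> events"
    using pred_determined[OF determined_finite_below] unfolding pred_def .
  have "(F_gen M k X s \<longlongrightarrow> prob ?E) (at_left 1)"
  proof (rule tendsto_at_left_sequentially[of 0])
    fix S :: "nat \<Rightarrow> real"
    assume S: "\<And>n. S n < 1" "\<And>n. 0 < S n" "S \<longlonglongrightarrow> 1"
    have "(\<lambda>n. \<integral>\<omega>. pow_card (S n) (?A \<omega>) \<partial>M) \<longlonglongrightarrow> (\<integral>\<omega>. indicator ?E \<omega> \<partial>M)"
    proof (rule integral_dominated_convergence[where w = "\<lambda>_. 1"])
      show "AE \<omega> in M. (\<lambda>n. pow_card (S n) (?A \<omega>)) \<longlonglongrightarrow> indicator ?E \<omega>"
      proof (rule AE_I2)
        fix \<omega> assume w: "\<omega> \<in> space M"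
        show "(\<lambda>n. pow_card (S n) (?A \<omega>)) \<longlonglongrightarrow> indicator ?E \<omega>"
        proof (cases "finite (?A \<omega>)")
          case True
          have "(\<lambda>n. S n ^ card (?A \<omega>)) \<longlonglongrightarrow> 1 ^ card (?A \<omega>)"
            by (rule tendsto_power[OF S(3)])
          then show ?thesis using True w by (simp add: pow_card_def)
        next
          case False
          have "S n \<noteq> 1" for n using S(1)[of n] by simp
          then show ?thesis using False by (simp add: pow_card_def)
        qed
      qed
      show "AE \<omega> in M. norm (pow_card (S n) (?A \<omega>)) \<le> 1" for n
        using S(1,2)[of n] by (intro AE_I2) (simp add: pow_card_def power_le_one less_imp_le)
      show "(\<lambda>\<omega>. pow_card (S n) (?A \<omega>)) \<in> borel_measurable M" for n
        by (rule borel_measurable_pow_card[OF pred_in_below])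
      show "(indicator ?E :: _ \<Rightarrow> real) \<in> borel_measurable M"
        by (rule borel_measurable_indicator[OF E])
    qed simp
    moreover have "(\<integral>\<omega>. indicator ?E \<omega> \<partial>M) = prob ?E"
      by (simp add: E)
    ultimately show "(\<lambda>n. F_gen M k X s (S n)) \<longlonglongrightarrow> prob ?E"
      by (simp only: F_gen_def component_root)
  qed (rule zero_less_one)
  then show ?thesis
    unfolding F_gen_left1_def by (rule tendsto_Lim[rotated]) simp
qed

text \<open>
  Inclusion-exclusion, obtained by integrating the expansion of
  $\prod_{j \in S} (1 - \mathbf{1}_{A_j})$.
\<close>
lemma prob_none_eq_sum:
  assumes fin: "finite S" and A: "\<And>j. j \<in> S \<Longrightarrow> {\<omega> \<in> space M. A j \<omega>} \<in> events"
  shows "\<P>(\<omega> in M. \<forall>j\<in>S. \<not> A j \<omega>) = (\<Sum>J\<in>Pow S. (-1) ^ card J * \<P>(\<omega> in M. \<forall>j\<in>J. A j \<omega>))"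
proof -
  let ?E = "\<lambda>J. {\<omega> \<in> space M. \<forall>j\<in>J. A j \<omega>}"
  have E: "?E J \<in> events" if "J \<subseteq> S" for J
    by (rule sets.sets_Collect_finite_All[OF _ finite_subset[OF that fin]]) (use A that in blast)
  have "{\<omega> \<in> space M. \<forall>j\<in>S. \<not> A j \<omega>} \<in> events"
    by (rule sets.sets_Collect_finite_All[OF _ fin]) (rule sets.sets_Collect_neg[OF A])
  then have "\<P>(\<omega> in M. \<forall>j\<in>S. \<not> A j \<omega>) = (\<integral>\<omega>. indicator {\<omega> \<in> space M. \<forall>j\<in>S. \<not> A j \<omega>} \<omega> \<partial>M)"
    by simp
  also have "\<dots> = (\<integral>\<omega>. (\<Sum>J\<in>Pow S. (-1) ^ card J * indicator (?E J) \<omega>) \<partial>M)"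
  proof (rule Bochner_Integration.integral_cong[OF refl])
    fix \<omega> assume w: "\<omega> \<in> space M"
    have ind: "(\<Prod>j\<in>J. of_bool (P j) :: real) = of_bool (\<forall>j\<in>J. P j)" if "J \<subseteq> S" for J P
      using finite_subset[OF that fin] by (induction J rule: finite_induct) auto
    have "indicator {\<omega> \<in> space M. \<forall>j\<in>S. \<not> A j \<omega>} \<omega> = (\<Prod>j\<in>S. of_bool (\<not> A j \<omega>) :: real)"
      using w by (subst ind) (auto simp: indicator_def)
    also have "\<dots> = (\<Prod>j\<in>S. - of_bool (A j \<omega>) + 1)"
      by (intro prod.cong) auto
    also have "\<dots> = (\<Sum>J\<in>Pow S. (\<Prod>j\<in>J. - of_bool (A j \<omega>)) * (\<Prod>j\<in>S - J. 1))"
      by (rule prod_add[OF fin])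
    also have "\<dots> = (\<Sum>J\<in>Pow S. (-1) ^ card J * indicator (?E J) \<omega>)"
      using w by (intro sum.cong refl) (simp add: prod_uminus ind indicator_def)
    finally show "indicator {\<omega> \<in> space M. \<forall>j\<in>S. \<not> A j \<omega>} \<omega>
        = (\<Sum>J\<in>Pow S. (-1) ^ card J * indicator (?E J) \<omega> :: real)" .
  qed
  also have "\<dots> = (\<Sum>J\<in>Pow S. (-1) ^ card J * prob (?E J))"
    using E by (subst Bochner_Integration.integral_sum) (auto simp: emeasure_eq_measure)
  finally show ?thesis .
qed

end

section \<open>The formula for the probability of infinitely many friends\<close>

context positive_ecbp
begin

lemma f_star_eq_prob_good:
  assumes "k \<ge> 1"
  shows "f_star M k X = \<P>(\<omega> in M. good k (X \<omega>))"
  unfolding f_star_def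
proof (rule finite_measure_eq_AE)
  show "AE \<omega> in M. \<omega> \<in> {\<omega> \<in> space M. infinite (friends k (X \<omega>) [])} \<longleftrightarrow>
      \<omega> \<in> {\<omega> \<in> space M. good k (X \<omega>)}"
    using AE_infinite_good_vertices[OF assms]
    by eventually_elim (use good_if_infinite_friends infinite_friends_if_good in blast)
  show "{\<omega> \<in> space M. infinite (friends k (X \<omega>) [])} \<in> events"
    using pred_determined[OF determined_infinite_friends] unfolding pred_def .
  show "{\<omega> \<in> space M. good k (X \<omega>)} \<in> events"
    using pred_determined[OF determined_good] unfolding pred_def .
qed

text \<open>
  The core is the union of the components of the root in at most $h$ colors, which are all
  subcritical.
\<close>
lemma AE_finite_core:
  assumes "\<And>I. I \<subseteq> {1..k} \<Longrightarrow> card I \<le> h \<Longrightarrow> (\<Sum>i\<in>I. lam i) < 1"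
  shows "AE \<omega> in M. finite (core k h (X \<omega>))"
proof -
  let ?S = "{I \<in> Pow {1..k}. card I \<le> h}"
  have "AE \<omega> in M. \<forall>I\<in>?S. finite (below k (X \<omega>) I)"
    using assms by (intro AE_finite_allI AE_finite_below_subcritical) auto
  then show ?thesis
  proof eventually_elim
    fix \<omega> assume fin: "\<forall>I\<in>?S. finite (below k (X \<omega>) I)"
    have "core k h (X \<omega>) \<subseteq> (\<Union>I\<in>?S. below k (X \<omega>) I)"
    proof
      fix v assume v: "v \<in> core k h (X \<omega>)"
      then have "v \<in> below k (X \<omega>) (fst ` set v)" by (simp add: core_def below_def)
      moreover have "fst ` set v \<in> ?S" using v tree_colors[of v k "X \<omega>"] by (simp add: core_def)
      ultimately show "v \<in> (\<Union>I\<in>?S. below k (X \<omega>) I)" by blast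
    qed
    moreover have "finite (\<Union>I\<in>?S. below k (X \<omega>) I)" using fin by simp
    ultimately show "finite (core k h (X \<omega>))" by (rule finite_subset)
  qed
qed

text \<open>
  At the exit $(v,i)$ of a core with $h = k-2$ colors, the path has seen $k-1$ colors, so it
  matters for the component without color $j$ for exactly one $j$. The condition $Q$ on the subtrees
  behind this exit is void if that $j$ is outside $J$, which matches the weight one.
\<close>
lemma q_weight_eq:
  assumes k: "k = h + 2" and vi: "(v, i) \<in> exits k h K" and v: "v \<in> tree k x"
    and Q: "\<And>y. Q y \<longleftrightarrow> ((\<exists>j\<in>J. insert i (fst ` set v) = {1..k} - {j}) \<longrightarrow>
      finite (below k y (insert i (fst ` set v))))"
  shows "q_weight M k lam X (L_set k J) (first_colors v) i = exp (lam i * (\<P>(\<omega> in M. Q (X \<omega>)) - 1))"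
proof -
  have "first_colors v @ [i] \<in> strings k (k - 1)"
    using first_colors_in_strings[OF v] vi k
    by (auto simp: strings_def exits_def set_first_colors)
  then have "first_colors v @ [i] \<in> L_set k J \<longleftrightarrow> (\<exists>j\<in>J. insert i (fst ` set v) = {1..k} - {j})"
    by (auto simp: L_set_def strings_avoiding_def set_first_colors)
  then show ?thesis
    by (simp add: q_weight_def F_gen_left1_eq set_first_colors Q prob_space)
qed

text \<open>
  Conditionally on the core being a fixed finite set $K$, the event is a conjunction over the exits
  of $K$ of conditions on unexplored subtrees. The branching property turns its probability into
  a product over the exits of $K$, and \<open>prod_strings_eq_prod_exits\<close> identifies this product
  as the integrand of $\Phi_h$.
\<close>
lemma prob_all_finite_eq_Phi:
  assumes k: "k = h + 2" and J: "J \<subseteq> {1..k}"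
    and sub: "\<And>I. I \<subseteq> {1..k} \<Longrightarrow> card I \<le> h \<Longrightarrow> (\<Sum>i\<in>I. lam i) < 1"
  shows "\<P>(\<omega> in M. \<forall>j\<in>J. finite (below k (X \<omega>) ({1..k} - {j}))) =
    Phi M k X h (\<lambda>s. \<Prod>i\<in>{1..k} - set s. q_weight M k lam X (L_set k J) s i)"
proof -
  let ?w = "q_weight M k lam X (L_set k J)"
  define Q where "Q v i y \<longleftrightarrow> ((\<exists>j\<in>J. insert i (fst ` set v) = {1..k} - {j}) \<longrightarrow>
      finite (below k y (insert i (fst ` set v))))" for v :: vertex and i y
  define g where "g K = (\<Prod>(v, i)\<in>exits k h K. ?w (first_colors v) i)" for K
  define f where "f \<omega> = (\<Prod>s\<in>strings k h. pow_card (\<Prod>i\<in>{1..k} - set s. ?w s i) (R_set k (X \<omega>) s))" for \<omega>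
  let ?E = "\<lambda>x. \<forall>j\<in>J. finite (below k x ({1..k} - {j}))"
  have detE: "determined k UNIV ?E"
    by (intro determined_ball determined_finite_below)
  have detQ: "determined k UNIV (Q v i)" for v i
    unfolding Q_def[abs_def] by (intro determined_imp determined_const determined_finite_below)
  have det_in: "determined k UNIV (\<lambda>x. v \<in> core k h x)" for v
    unfolding core_def mem_Collect_eq
    by (intro determined_conj determined_const determined_mono[OF determined_tree]) simp
  have E_iff: "?E x \<longleftrightarrow> (\<forall>(v, i)\<in>exits k h (core k h x). \<forall>n<x v i. Q v i (subtree (v @ [(i, n)]) x))"
    if fin: "finite (core k h x)" for x
  proof -
    have "finite (below k x ({1..k} - {j})) \<longleftrightarrow>
        (\<forall>(v, i)\<in>exits k h (core k h x). insert i (fst ` set v) = {1..k} - {j} \<longrightarrow>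
          (\<forall>n<x v i. finite (below k (subtree (v @ [(i, n)]) x) ({1..k} - {j}))))"
      if "j \<in> J" for j
      using that J k by (intro finite_below_exits_iff[OF fin]) auto
    then show ?thesis unfolding Q_def by fastforce
  qed
  have "\<P>(\<omega> in M. ?E (X \<omega>)) = (\<integral>\<omega>. f \<omega> \<partial>M)"
  proof (rule prob_eq_integral_countable_partition[where A = "\<lambda>\<omega>. core k h (X \<omega>)" and g = g])
    show "Measurable.pred M (\<lambda>\<omega>. v \<in> core k h (X \<omega>))" for v
      by (rule pred_determined[OF det_in])
    show "Measurable.pred M (\<lambda>\<omega>. ?E (X \<omega>))"
      by (rule pred_determined[OF detE])
    show "AE \<omega> in M. finite (core k h (X \<omega>))"
      using sub by (rule AE_finite_core)
    show "f \<omega> = g (core k h (X \<omega>))" if "finite (core k h (X \<omega>))" for \<omega>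
      unfolding f_def g_def by (rule prod_strings_eq_prod_exits[OF that])
    show "integrable M f"
    proof (rule integrable_const_bound[where B = 1])
      have w: "0 \<le> ?w s i" "?w s i \<le> 1" if "i \<in> {1..k}" for s i
        using lam_pos[OF that] by (auto simp: q_weight_def F_gen_left1_eq mult_le_0_iff)
      have "pow_card (\<Prod>i\<in>{1..k} - set s. ?w s i) A \<in> {0..1}" for s and A :: "vertex set"
      proof -
        have "(\<Prod>i\<in>{1..k} - set s. ?w s i) \<in> {0..1}"
          using w by (auto intro!: prod_nonneg prod_le_1)
        then show ?thesis by (simp add: pow_card_def power_le_one)
      qed
      then show "AE \<omega> in M. norm (f \<omega>) \<le> 1"
        by (intro AE_I2) (auto simp: f_def abs_prod intro!: prod_le_1)
      have "Measurable.pred M (\<lambda>\<omega>. v \<in> R_set k (X \<omega>) s)" for v s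
        unfolding R_set_def mem_Collect_eq
        by (intro pred_determined[where B = UNIV] determined_conj determined_const
            determined_mono[OF determined_tree]) simp
      then show "f \<in> borel_measurable M"
        unfolding f_def[abs_def] by (intro borel_measurable_prod borel_measurable_pow_card)
    qed
    show "\<P>(\<omega> in M. core k h (X \<omega>) = K \<and> ?E (X \<omega>)) = \<P>(\<omega> in M. core k h (X \<omega>) = K) * g K"
      if K: "finite K" for K
    proof (cases "\<exists>x. core k h x = K")
      case False
      then show ?thesis by simp
    next
      case True
      then obtain x where x: "core k h x = K" ..
      have "{\<omega> \<in> space M. core k h (X \<omega>) = K \<and> ?E (X \<omega>)} = {\<omega> \<in> space M. core k h (X \<omega>) = K \<and>
          (\<forall>(v, i)\<in>exits k h K. \<forall>n<X \<omega> v i. Q v i (subtree (v @ [(i, n)]) (X \<omega>)))}"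
        using E_iff K by (intro Collect_cong conj_cong refl) auto
      also have "prob \<dots> = \<P>(\<omega> in M. core k h (X \<omega>) = K) *
          (\<Prod>(v, i)\<in>exits k h K. exp (lam i * (\<P>(\<omega> in M. Q v i (X \<omega>)) - 1)))"
        by (rule prob_separated_children[OF finite_exits[OF K] _ exits_antichain determined_core core_block_disjoint detQ])
          (auto simp: exits_def)
      also have "(\<Prod>(v, i)\<in>exits k h K. exp (lam i * (\<P>(\<omega> in M. Q v i (X \<omega>)) - 1))) = g K"
        unfolding g_def
      proof (intro prod.cong refl, clarify)
        fix v i assume vi: "(v, i) \<in> exits k h K"
        then have "v \<in> core k h x" unfolding x exits_def by blast
        then have "v \<in> tree k x" by (simp add: core_def)
        then show "exp (lam i * (\<P>(\<omega> in M. Q v i (X \<omega>)) - 1)) = ?w (first_colors v) i"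
          using q_weight_eq[OF k vi, of x "Q v i" J] by (simp add: Q_def)
      qed
      finally show ?thesis .
    qed
  qed
  then show ?thesis
    unfolding f_def Phi_def .
qed

end

theorem theorem6p2p5:
  fixes M :: "'w measure" and k :: nat and lam :: "nat \<Rightarrow> real"
    and X :: "'w \<Rightarrow> vertex \<Rightarrow> nat \<Rightarrow> nat"
  assumes "k \<ge> 2"
    and "\<And>i. i \<in> {1..k} \<Longrightarrow> lam i > 0"
    and "\<And>I. I \<subseteq> {1..k} \<Longrightarrow> card I \<le> k - 2 \<Longrightarrow> (\<Sum>i\<in>I. lam i) < 1"
    and "ecbp M k lam X"
  shows "f_star M k X =
    (\<Sum>J\<in>Pow {1..k}. (-1) ^ card J *
       Phi M k X (k - 2) (\<lambda>s. \<Prod>i\<in>{1..k} - set s. q_weight M k lam X (L_set k J) s i))"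
proof -
  interpret ecbp M k lam X by fact
  interpret positive_ecbp M k lam X
    by unfold_locales (rule assms(2))
  have "f_star M k X = \<P>(\<omega> in M. \<forall>j\<in>{1..k}. \<not> finite (below k (X \<omega>) ({1..k} - {j})))"
    using assms(1) by (simp add: f_star_eq_prob_good good_def)
  also have "\<dots> = (\<Sum>J\<in>Pow {1..k}. (-1) ^ card J *
      \<P>(\<omega> in M. \<forall>j\<in>J. finite (below k (X \<omega>) ({1..k} - {j}))))"
    using pred_determined[OF determined_finite_below] unfolding pred_def
    by (intro prob_none_eq_sum) simp_all
  also have "\<dots> = (\<Sum>J\<in>Pow {1..k}. (-1) ^ card J *
       Phi M k X (k - 2) (\<lambda>s. \<Prod>i\<in>{1..k} - set s. q_weight M k lam X (L_set k J) s i))"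
    using assms(1,3) by (intro sum.cong refl arg_cong2[of _ _ _ _ "(*)"] prob_all_finite_eq_Phi) auto
  finally show ?thesis .
qed

end
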